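(* Let $\mu_0,\mu_1$ be as in the context. There exist $C,\varepsilon_0>0$ such that for every $0<\varepsilon<\varepsilon_0$: (i) the Hausdorff distance between the optimal supports satisfies $$C^{-1}\varepsilon^{\frac13}\le\big\|d(\mathcal{S}_{x,\varepsilon},T_0(x))\big\|_{L^2(\Omega_0,dx)}\le C\varepsilon^{\frac13};$$ (ii) the derivatives $f_\varepsilon'$ converge to Monge's map $T_0=f_0'$ according to $$\|f_\varepsilon'-T_0\|_{L^2(\Omega_0,dx)}\le C\varepsilon^{\frac13}.$$
   Context: Standing assumption: for $i=0,1$, $\mu_i$ is a probability measure on $\mathbb{R}$ supported on a compact interval $\Omega_i=[a_i,b_i]$, with a continuous density $u_i\in\mathcal{C}(\Omega_i)$ (i.e. $d\mu_i=u_i\,dx$) satisfying $0<\lambda\le u_i\le\Lambda<\infty$ on $\Omega_i$ for constants $\lambda,\Lambda$. For $\varepsilon>0$, let $\pi_\varepsilon$ be the unique minimizer over couplings $\pi\in\Pi(\mu_0,\mu_1)$ of $\int\frac12(x-y)^2\,d\pi+\frac{\varepsilon}{2}\int\big(\frac{d\pi}{d(\mu_0\otimes\mu_1)}\big)^2d(\mu_0\otimes\mu_1)$. The potentials $(f_\varepsilon,g_\varepsilon)$ are continuous functions $f_\varepsilon:\Omega_0\to\mathbb{R}$, $g_\varepsilon:\Omega_1\to\mathbb{R}$ with $\frac{d\pi_\varepsilon}{d(\mu_0\otimes\mu_1)}(x,y)=\big(\frac{xy-f_\varepsilon(x)-g_\varepsilon(y)}{\varepsilon}\big)_+$, where $(a)_+=\max(a,0)$;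 equivalently they satisfy $\int(xy-f_\varepsilon(x)-g_\varepsilon(y))_+\,d\mu_1(y)=\varepsilon$ for all $x\in\Omega_0$ and $\int(xy-f_\varepsilon(x)-g_\varepsilon(y))_+\,d\mu_0(x)=\varepsilon$ for all $y\in\Omega_1$. They exist and are unique up to replacing $(f_\varepsilon,g_\varepsilon)$ by $(f_\varepsilon+\alpha,g_\varepsilon-\alpha)$, $\alpha\in\mathbb{R}$. The function $f_\varepsilon$ is continuously differentiable on $\Omega_0$. The $x$-section of the support is the interval $\mathcal{S}_{x,\varepsilon}:=\{y\in\Omega_1:\ xy-f_\varepsilon(x)-g_\varepsilon(y)\ge0\}$. $T_0:\Omega_0\to\Omega_1$ is the optimal transport (Monge) map from $\mu_0$ to $\mu_1$ for quadratic cost, i.e. $T_0=F_1^{-1}\circ F_0$ with $F_i(x)=\mu_i((-\infty,x])$; it is the derivative $T_0=f_0'$ of the convex Kantorovich potential $f_0$. The Hausdorff distance between $\mathcal{S}_{x,\varepsilon}$ and $\{T_0(x)\}$ is $d(\mathcal{S}_{x,\varepsilon},T_0(x))=\sup_{y\in\mathcal{S}_{x,\varepsilon}}|y-T_0(x)|$. The norm is $\|h\|_{L^2(\Omega_0,dx)}=\big(\int_{\Omega_0}h(x)^2\,dx\big)^{1/2}$. *)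

theory Defs
  imports "HOL-Probability.Probability"
begin

definition couplings :: "'a measure \<Rightarrow> 'b measure \<Rightarrow> ('a \<times> 'b) measure set" where
  "couplings M N =
     {\<pi>. sets \<pi> = sets (M \<Otimes>\<^sub>M N) \<and> distr \<pi> M fst = M \<and> distr \<pi> N snd = N}"

text \<open>The quadratic penalty is \<open>\<infinity>\<close> for plans without a density with respect to the product measure.\<close>

definition qot_cost :: "real \<Rightarrow> real measure \<Rightarrow> real measure \<Rightarrow> (real \<times> real) measure \<Rightarrow> ennreal" where
  "qot_cost \<epsilon> M N \<pi> =
     (if absolutely_continuous (M \<Otimes>\<^sub>M N) \<pi>
      then (\<integral>\<^sup>+ (x, y). ennreal ((x - y)\<^sup>2 / 2) \<partial>\<pi>)
           + ennreal (\<epsilon> / 2) * (\<integral>\<^sup>+ p. (RN_deriv (M \<Otimes>\<^sub>M N) \<pi> p)\<^sup>2 \<partial>(M \<Otimes>\<^sub>M N))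
      else \<infinity>)"

definition qot_plan :: "real \<Rightarrow> real measure \<Rightarrow> real measure \<Rightarrow> (real \<times> real) measure \<Rightarrow> bool" where
  "qot_plan \<epsilon> M N \<pi> \<longleftrightarrow> is_arg_min (qot_cost \<epsilon> M N) (\<lambda>\<rho>. \<rho> \<in> couplings M N) \<pi>"

text \<open>
  Potentials are total functions of which only the values on the compact sets \<open>X\<close> and \<open>Y\<close> carrying
  \<open>M\<close> and \<open>N\<close> matter; an almost-everywhere statement for the product measure does not see the rest.
\<close>

definition qot_potentials ::
    "real \<Rightarrow> real set \<Rightarrow> real set \<Rightarrow> real measure \<Rightarrow> real measure \<Rightarrow> (real \<Rightarrow> real) \<Rightarrow> (real \<Rightarrow> real) \<Rightarrow> bool" where
  "qot_potentials \<epsilon> X Y M N f g \<longleftrightarrow>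
     continuous_on X f \<and> continuous_on Y g \<and>
     (\<exists>\<pi>. qot_plan \<epsilon> M N \<pi> \<and> absolutely_continuous (M \<Otimes>\<^sub>M N) \<pi> \<and>
          (AE (x, y) in M \<Otimes>\<^sub>M N.
             RN_deriv (M \<Otimes>\<^sub>M N) \<pi> (x, y) = ennreal (max ((x * y - f x - g y) / \<epsilon>) 0)))"

definition support_section :: "real set \<Rightarrow> (real \<Rightarrow> real) \<Rightarrow> (real \<Rightarrow> real) \<Rightarrow> real \<Rightarrow> real set" where
  "support_section Y f g x = {y \<in> Y. x * y - f x - g y \<ge> 0}"

text \<open>Hausdorff distance between \<open>S\<close> and the singleton \<open>{t}\<close>, for nonempty bounded \<open>S\<close>.\<close>

definition dist_to_singleton :: "real set \<Rightarrow> real \<Rightarrow> real" where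
  "dist_to_singleton S t = (SUP y\<in>S. \<bar>y - t\<bar>)"

text \<open>
  The distribution function of \<open>N\<close> is inverted on the interval \<open>Y\<close> carrying \<open>N\<close>, where it is
  strictly increasing.
\<close>

definition monge_map :: "real set \<Rightarrow> real measure \<Rightarrow> real measure \<Rightarrow> real \<Rightarrow> real" where
  "monge_map Y M N x = inv_into Y (cdf N) (cdf M x)"

definition square_integrable_on :: "real set \<Rightarrow> (real \<Rightarrow> real) \<Rightarrow> bool" where
  "square_integrable_on X h \<longleftrightarrow>
     set_borel_measurable lborel X h \<and> set_integrable lborel X (\<lambda>x. (h x)\<^sup>2)"

definition L2_norm_on :: "real set \<Rightarrow> (real \<Rightarrow> real) \<Rightarrow> real" where
  "L2_norm_on X h = sqrt (LINT x:X|lborel. (h x)\<^sup>2)"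

end

theory Submission imports Defs
begin

text \<open>Write \<open>h(x, y) = x * y - f x - g y\<close>, let \<open>S x\<close> be the section \<open>{y. 0 \<le> h(x, y)}\<close>, \<open>T\<close> the monotone
transport map, and \<open>D x\<close> the largest distance from a point of \<open>S x\<close> to \<open>T x\<close>.  The plan has density
\<open>max (h(x, y)) 0 / \<epsilon>\<close>, so its marginal conditions say that the positive part of \<open>h\<close> integrates to
\<open>\<epsilon>\<close> along every horizontal and every vertical line.

One such equation already determines the shape of \<open>f\<close>: the barycenter of \<open>S x\<close> is a subgradient of
\<open>f\<close> at \<open>x\<close> (\<open>barycenter_subgradient\<close>).  Hence \<open>f\<close> and, symmetrically, \<open>g\<close> are convex, \<open>h\<close> is concave
in each variable, the barycenter depends continuously on \<open>x\<close>, and it equals \<open>f'(x)\<close>.  In particular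
\<open>\<bar>f'(x) - T x\<bar> \<le> D x\<close>, and both parts of the theorem become bounds for the mean square of \<open>D\<close>.

Upper bound.  A concave function on an interval cannot have most of its mass near \<open>T x\<close> if it is
positive up to distance \<open>D x\<close> from \<open>T x\<close> (\<open>concave_second_moment\<close>), so the mean square of \<open>D\<close> is bounded
by the second moment of \<open>y - T x\<close> under the plan.  As \<open>T\<close> is bi-Lipschitz, the Kantorovich potentials
of \<open>T\<close> turn that second moment into the excess transport cost of the plan
(\<open>convex_potential_exists\<close>).  The explicit form of the density makes the plan optimal for cost plus
penalty (\<open>\<rho>_optimal\<close>), and a competitor which couples the \<open>n\<close> quantile blocks of the two measures
independently has excess cost of order \<open>1 / n\<^sup>2\<close> and penalty of order \<open>\<epsilon> * n\<close>.  Taking \<open>n\<close> of order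
\<open>\<epsilon> powr (-1/3)\<close> bounds the mean square of \<open>D\<close> by a multiple of \<open>\<epsilon> powr (2/3)\<close>.

Lower bound.  On the support the \<open>x\<close>-derivative of \<open>h\<close> is \<open>y - f'(x)\<close>, of modulus at most \<open>2 * D x\<close>.
Fix \<open>y\<close> and suppose that \<open>h(x, y) < 0\<close> for some \<open>x\<close>.  Then \<open>h\<close> vanishes at an end of the section at
height \<open>y\<close>, so on that section \<open>h \<le> A y\<close>, where \<open>A y\<close> is a multiple of the integral of \<open>D\<close> over it,
and the marginal equation gives \<open>\<epsilon> \<le> A y * m y\<close> with \<open>m y\<close> its mass.  By Fubini the integral of \<open>A\<close>
is at most of order \<open>\<integral>D\<^sup>2\<close> and that of \<open>m\<close> at most of order \<open>\<integral>D\<close>; by Cauchy-Schwarz \<open>\<epsilon>\<close> is at most of order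
\<open>(\<integral>D\<^sup>2) powr (3/2)\<close> (\<open>mean_sq_dist_lower_partial_sections\<close>).  If instead one section at height \<open>y\<close>
is the whole interval, then \<open>D\<close> dominates \<open>\<bar>y - T\<bar>\<close>, whose mean square is bounded below because
\<open>T\<close> is not nearly constant on any large set (\<open>mean_sq_dist_lower_full_section\<close>).\<close>

section \<open>Convex functions of one variable\<close>

text \<open>On either side of a point where it is negative, a convex function has at most one zero.\<close>

lemma convex_on_zeros_finite:
  fixes \<phi> :: "real \<Rightarrow> real"
  assumes conv: "convex_on {c..d} \<phi>" and z: "z \<in> {c..d}" "\<phi> z < 0"
  shows "finite {y \<in> {c..d}. \<phi> y = 0}"
proof -
  have no2: False
    if "p \<in> {c..d}" "q \<in> {c..d}" "\<phi> p = 0" "\<phi> q = 0" and betw: "p < q \<and> q < z \<or> z < q \<and> q < p" for p q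
  proof -
    define t where "t = (q - p) / (z - p)"
    have t: "0 < t" "t < 1" "q = (1 - t) *\<^sub>R p + t *\<^sub>R z"
      using betw by (auto simp: t_def divide_simps) (auto simp: algebra_simps)
    have "\<phi> q \<le> (1 - t) * \<phi> p + t * \<phi> z"
      unfolding t(3) using t that z by (intro convex_onD[OF conv]) auto
    then show False using that z t by (simp add: mult_pos_neg zero_le_mult_iff not_le)
  qed
  have "finite {y \<in> {c..d}. \<phi> y = 0 \<and> y < z}"
  proof (cases "{y \<in> {c..d}. \<phi> y = 0 \<and> y < z} = {}")
    case False
    then obtain p where "p \<in> {c..d}" "\<phi> p = 0" "p < z" by auto
    then have "q = p" if "q \<in> {c..d}" "\<phi> q = 0" "q < z" for q
      using no2[of p q] no2[of q p] that by (cases p q rule: linorder_cases) auto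
    then have "{y \<in> {c..d}. \<phi> y = 0 \<and> y < z} \<subseteq> {p}" by auto
    then show ?thesis by (rule finite_subset) simp
  qed (simp only: finite.emptyI)
  moreover have "finite {y \<in> {c..d}. \<phi> y = 0 \<and> z < y}"
  proof (cases "{y \<in> {c..d}. \<phi> y = 0 \<and> z < y} = {}")
    case False
    then obtain p where "p \<in> {c..d}" "\<phi> p = 0" "z < p" by auto
    then have "q = p" if "q \<in> {c..d}" "\<phi> q = 0" "z < q" for q
      using no2[of p q] no2[of q p] that by (cases p q rule: linorder_cases) auto
    then have "{y \<in> {c..d}. \<phi> y = 0 \<and> z < y} \<subseteq> {p}" by auto
    then show ?thesis by (rule finite_subset) simp
  qed (simp only: finite.emptyI)
  moreover have "{y \<in> {c..d}. \<phi> y = 0} \<subseteq>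
      {y \<in> {c..d}. \<phi> y = 0 \<and> y < z} \<union> {y \<in> {c..d}. \<phi> y = 0 \<and> z < y}"
    using z by (auto simp: not_less_iff_gr_or_eq)
  ultimately show ?thesis by (meson finite_UnI finite_subset)
qed

lemma convex_on_if_subgradients:
  fixes \<phi> m :: "real \<Rightarrow> real"
  assumes "convex S" "\<And>x y. x \<in> S \<Longrightarrow> y \<in> S \<Longrightarrow> \<phi> x + (y - x) * m x \<le> \<phi> y"
  shows "convex_on S \<phi>"
proof (rule convex_onI)
  fix t x y :: real
  assume t: "0 < t" "t < 1" and xy: "x \<in> S" "y \<in> S"
  define z where "z = (1 - t) *\<^sub>R x + t *\<^sub>R y"
  have z: "z \<in> S" unfolding z_def using assms(1) t xy by (intro convexD) auto
  have "(1 - t) * (\<phi> z + (x - z) * m z) \<le> (1 - t) * \<phi> x"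
    using assms(2)[OF z xy(1)] t by (intro mult_left_mono) auto
  moreover have "t * (\<phi> z + (y - z) * m z) \<le> t * \<phi> y"
    using assms(2)[OF z xy(2)] t by (intro mult_left_mono) auto
  moreover have "(1 - t) * (\<phi> z + (x - z) * m z) + t * (\<phi> z + (y - z) * m z) = \<phi> z"
    unfolding z_def by (simp add: algebra_simps)
  ultimately show "\<phi> ((1 - t) *\<^sub>R x + t *\<^sub>R y) \<le> (1 - t) * \<phi> x + t * \<phi> y"
    unfolding z_def by linarith
qed (use assms in auto)

text \<open>After subtracting \<open>k / 2 * (s - t)\<^sup>2\<close> the derivative \<open>R s - R t - k * (s - t)\<close> still has the sign of
\<open>s - t\<close>, so the difference has its minimum at \<open>t\<close>.  The constant \<open>k\<close> may be negative: applied to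
\<open>-G\<close>, the lemma also gives upper bounds.\<close>

lemma derivative_expansive_imp_quadratic_growth:
  fixes G R :: "real \<Rightarrow> real"
  assumes der: "\<And>s. s \<in> {c..d} \<Longrightarrow> (G has_real_derivative R s) (at s within {c..d})"
    and R: "\<And>s s'. s \<in> {c..d} \<Longrightarrow> s' \<in> {c..d} \<Longrightarrow> s \<le> s' \<Longrightarrow> k * (s' - s) \<le> R s' - R s"
    and t: "t \<in> {c..d}" and y: "y \<in> {c..d}"
  shows "k / 2 * (y - t)\<^sup>2 \<le> G y - G t - R t * (y - t)"
proof -
  define \<phi> where "\<phi> s = G s - R t * s - k / 2 * (s - t)\<^sup>2" for s
  have d\<phi>: "(\<phi> has_real_derivative (R s - R t - k * (s - t))) (at s within {c..d})" if "s \<in> {c..d}" for s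
    unfolding \<phi>_def by (auto intro!: derivative_eq_intros der that)
  have cont: "continuous_on {c..d} \<phi>"
    using d\<phi> by (meson DERIV_continuous continuous_on_eq_continuous_within)
  have d\<phi>': "(\<phi> has_real_derivative (R s - R t - k * (s - t))) (at s)" if "c < s" "s < d" for s
    using d\<phi>[of s] that by (simp add: at_within_Icc_at)
  have "\<phi> t \<le> \<phi> y"
  proof (cases "t \<le> y")
    case True
    show ?thesis
    proof (rule DERIV_nonneg_imp_increasing_open[OF True])
      fix s assume "t < s" "s < y"
      then show "\<exists>D. DERIV \<phi> s :> D \<and> 0 \<le> D"
        using R[OF t, of s] d\<phi>'[of s] t y by (intro exI[of _ "R s - R t - k * (s - t)"]) auto
    qed (use t y in \<open>auto intro: continuous_on_subset[OF cont]\<close>)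
  next
    case False
    then have "y \<le> t" by simp
    then show ?thesis
    proof (rule DERIV_nonpos_imp_decreasing_open)
      fix s assume "y < s" "s < t"
      then show "\<exists>D. DERIV \<phi> s :> D \<and> D \<le> 0"
        using R[OF _ t, of s] d\<phi>'[of s] t y
        by (intro exI[of _ "R s - R t - k * (s - t)"]) (auto simp: right_diff_distrib)
    qed (use t y in \<open>auto intro: continuous_on_subset[OF cont]\<close>)
  qed
  then show ?thesis by (simp add: \<phi>_def algebra_simps)
qed

lemma square_integrable_on_cong:
  assumes "\<And>x. x \<in> X \<Longrightarrow> h x = h' x"
  shows "square_integrable_on X h = square_integrable_on X h'" "L2_norm_on X h = L2_norm_on X h'"
proof -
  have *: "(\<lambda>x. indicator X x *\<^sub>R h x) = (\<lambda>x. indicator X x *\<^sub>R h' x)"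
    "(\<lambda>x. indicator X x *\<^sub>R (h x)\<^sup>2) = (\<lambda>x. indicator X x *\<^sub>R (h' x)\<^sup>2)"
    using assms by (auto simp: indicator_def)
  show "square_integrable_on X h = square_integrable_on X h'" "L2_norm_on X h = L2_norm_on X h'"
    unfolding square_integrable_on_def L2_norm_on_def set_borel_measurable_def
      set_integrable_def set_lebesgue_integral_def * by simp_all
qed

section \<open>Measures on an interval with density bounded above and below\<close>

locale interval_density = prob_space M for M :: "real measure" +
  fixes a b l L :: real and u :: "real \<Rightarrow> real"
  assumes M_eq: "M = density lborel (\<lambda>x. ennreal (indicator {a..b} x * u x))"
    and cont_u: "continuous_on {a..b} u"
    and l_pos: "0 < l"
    and u_bounds: "\<And>x. x \<in> {a..b} \<Longrightarrow> l \<le> u x \<and> u x \<le> L"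
begin

lemma sets_M [simp, measurable_cong]: "sets M = sets borel"
  by (subst M_eq) simp

lemma space_M [simp]: "space M = UNIV"
  by (subst M_eq) simp

lemma density_measurable [measurable]: "(\<lambda>x. indicator {a..b} x * u x) \<in> borel_measurable borel"
  using borel_measurable_continuous_on_indicator[OF _ cont_u] by simp

lemma AE_in_interval: "AE x in M. x \<in> {a..b}"
proof -
  have "AE x in lborel. 0 < ennreal (indicator {a..b} x * u x) \<longrightarrow> x \<in> {a..b}"
    by (auto simp: indicator_def)
  then show ?thesis
    by (subst M_eq, subst AE_density) auto
qed

lemma nn_integral_le:
  assumes [measurable]: "\<phi> \<in> borel_measurable borel"
  shows "(\<integral>\<^sup>+x. \<phi> x \<partial>M) \<le> ennreal L * (\<integral>\<^sup>+x. \<phi> x * indicator {a..b} x \<partial>lborel)"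
proof -
  have "(\<integral>\<^sup>+x. \<phi> x \<partial>M) = (\<integral>\<^sup>+x. ennreal (indicator {a..b} x * u x) * \<phi> x \<partial>lborel)"
    by (subst M_eq, subst nn_integral_density) auto
  also have "\<dots> \<le> (\<integral>\<^sup>+x. ennreal L * (\<phi> x * indicator {a..b} x) \<partial>lborel)"
    using u_bounds by (intro nn_integral_mono) (auto simp: indicator_def intro!: mult_right_mono ennreal_leI)
  also have "\<dots> = ennreal L * (\<integral>\<^sup>+x. \<phi> x * indicator {a..b} x \<partial>lborel)"
    by (intro nn_integral_cmult) auto
  finally show ?thesis .
qed

lemma nn_integral_ge:
  assumes [measurable]: "\<phi> \<in> borel_measurable borel"
  shows "ennreal l * (\<integral>\<^sup>+x. \<phi> x * indicator {a..b} x \<partial>lborel) \<le> (\<integral>\<^sup>+x. \<phi> x \<partial>M)"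
proof -
  have "ennreal l * (\<integral>\<^sup>+x. \<phi> x * indicator {a..b} x \<partial>lborel)
      = (\<integral>\<^sup>+x. ennreal l * (\<phi> x * indicator {a..b} x) \<partial>lborel)"
    by (intro nn_integral_cmult[symmetric]) auto
  also have "\<dots> \<le> (\<integral>\<^sup>+x. ennreal (indicator {a..b} x * u x) * \<phi> x \<partial>lborel)"
    using u_bounds by (intro nn_integral_mono) (auto simp: indicator_def intro!: mult_right_mono ennreal_leI)
  also have "\<dots> = (\<integral>\<^sup>+x. \<phi> x \<partial>M)"
    by (subst M_eq, subst nn_integral_density) auto
  finally show ?thesis .
qed

lemma a_less_b: "a < b"
proof (rule ccontr)
  assume *: "\<not> a < b"
  have "emeasure M UNIV \<le> ennreal L * (\<integral>\<^sup>+x. indicator {a..b} x \<partial>lborel)"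
    using nn_integral_le[of "\<lambda>_. 1"] by simp
  also have "\<dots> = 0" using * by (auto simp: nn_integral_indicator emeasure_lborel_Icc_eq)
  finally show False using emeasure_space_1 by simp
qed

lemma l_le_L: "l \<le> L" and L_pos: "0 < L"
  using u_bounds[of a] a_less_b l_pos by auto

lemma integrable_bounded:
  fixes \<phi> :: "real \<Rightarrow> real"
  assumes "\<phi> \<in> borel_measurable borel" "\<And>x. x \<in> {a..b} \<Longrightarrow> \<bar>\<phi> x\<bar> \<le> B"
  shows "integrable M \<phi>"
proof (rule integrable_const_bound[of _ B])
  show "AE x in M. norm (\<phi> x) \<le> B"
    using AE_in_interval by eventually_elim (use assms in auto)
qed (use assms in \<open>simp add: measurable_def\<close>)

lemma integrable_continuous:
  fixes \<phi> :: "real \<Rightarrow> real"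
  assumes "continuous_on UNIV \<phi>"
  shows "integrable M \<phi>"
proof -
  have "compact (\<phi> ` {a..b})"
    using assms by (intro compact_continuous_image) (auto intro: continuous_on_subset)
  then obtain B where "\<And>x. x \<in> {a..b} \<Longrightarrow> \<bar>\<phi> x\<bar> \<le> B"
    using compact_imp_bounded[of "\<phi> ` {a..b}"] unfolding bounded_iff by force
  then show ?thesis
    using integrable_bounded borel_measurable_continuous_onI[OF assms] by blast
qed

lemma integral_cong_interval:
  fixes \<phi> \<psi> :: "real \<Rightarrow> real"
  assumes "\<phi> \<in> borel_measurable borel" "\<psi> \<in> borel_measurable borel"
    and "\<And>x. x \<in> {a..b} \<Longrightarrow> \<phi> x = \<psi> x"
  shows "(\<integral>x. \<phi> x \<partial>M) = (\<integral>x. \<psi> x \<partial>M)"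
  using assms by (intro integral_cong_AE eventually_mono[OF AE_in_interval]) auto

lemma integral_mono_interval:
  fixes \<phi> \<psi> :: "real \<Rightarrow> real"
  assumes "integrable M \<phi>" "integrable M \<psi>"
    and "\<And>x. x \<in> {a..b} \<Longrightarrow> \<phi> x \<le> \<psi> x"
  shows "(\<integral>x. \<phi> x \<partial>M) \<le> (\<integral>x. \<psi> x \<partial>M)"
  using assms by (intro integral_mono_AE eventually_mono[OF AE_in_interval]) auto

text \<open>The two bounds on the density make integration against \<open>M\<close> and Lebesgue integration over the
interval interchangeable up to constants.  All estimates below are proved for the former, where
the total mass is one, and transferred at the end.\<close>

lemma lebesgue_integral_comparison:
  fixes \<phi> :: "real \<Rightarrow> real"
  assumes meas [measurable]: "\<phi> \<in> borel_measurable borel"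
    and B: "\<And>x. x \<in> {a..b} \<Longrightarrow> 0 \<le> \<phi> x \<and> \<phi> x \<le> B"
  shows "set_integrable lborel {a..b} \<phi>"
    and "l * (LINT x:{a..b}|lborel. \<phi> x) \<le> (\<integral>x. \<phi> x \<partial>M)"
    and "(\<integral>x. \<phi> x \<partial>M) \<le> L * (LINT x:{a..b}|lborel. \<phi> x)"
proof -
  show int: "set_integrable lborel {a..b} \<phi>"
    unfolding set_integrable_def
    by (rule integrableI_bounded_set_indicator[where B=B]) (use B in \<open>auto simp: emeasure_lborel_Icc_eq\<close>)
  define \<psi> where "\<psi> x = indicator {a..b} x * \<phi> x" for x
  have [measurable]: "\<psi> \<in> borel_measurable borel" unfolding \<psi>_def by measurable
  have pos: "0 \<le> \<psi> x" for x using B by (auto simp: \<psi>_def indicator_def)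
  have eqM: "(\<integral>x. \<phi> x \<partial>M) = (\<integral>x. \<psi> x \<partial>M)"
    by (rule integral_cong_interval) (auto simp: \<psi>_def)
  have intM: "integrable M \<psi>"
    by (rule integrable_bounded[where B=B]) (use B in \<open>auto simp: \<psi>_def\<close>)
  have eqL: "(LINT x:{a..b}|lborel. \<phi> x) = (\<integral>x. \<psi> x \<partial>lborel)" and intL: "integrable lborel \<psi>"
    using int by (auto simp: \<psi>_def[abs_def] set_lebesgue_integral_def set_integrable_def)
  have nM: "(\<integral>\<^sup>+x. \<psi> x \<partial>M) = ennreal (\<integral>x. \<psi> x \<partial>M)"
    using intM pos by (intro nn_integral_eq_integral) auto
  have "(\<integral>\<^sup>+x. ennreal (\<psi> x) * indicator {a..b} x \<partial>lborel) = (\<integral>\<^sup>+x. ennreal (\<psi> x) \<partial>lborel)"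
    by (intro nn_integral_cong) (auto simp: \<psi>_def indicator_def)
  also have "\<dots> = ennreal (\<integral>x. \<psi> x \<partial>lborel)"
    using intL pos by (intro nn_integral_eq_integral) auto
  finally have nL: "(\<integral>\<^sup>+x. ennreal (\<psi> x) * indicator {a..b} x \<partial>lborel) = ennreal (\<integral>x. \<psi> x \<partial>lborel)" .
  have p1: "0 \<le> (\<integral>x. \<psi> x \<partial>lborel)" and p2: "0 \<le> (\<integral>x. \<psi> x \<partial>M)"
    using pos by (auto intro!: integral_nonneg_AE)
  show "l * (LINT x:{a..b}|lborel. \<phi> x) \<le> (\<integral>x. \<phi> x \<partial>M)"
    using nn_integral_ge[of "\<lambda>x. ennreal (\<psi> x)"] p1 p2 l_pos
    unfolding nM nL eqM eqL by (simp add: ennreal_mult[symmetric])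
  show "(\<integral>x. \<phi> x \<partial>M) \<le> L * (LINT x:{a..b}|lborel. \<phi> x)"
    using nn_integral_le[of "\<lambda>x. ennreal (\<psi> x)"] p1 p2 L_pos
    unfolding nM nL eqM eqL by (simp add: ennreal_mult[symmetric])
qed

lemma measure_le_length:
  assumes "A \<in> sets borel" "A \<inter> {a..b} \<subseteq> {s..t}" "s \<le> t"
  shows "measure M A \<le> L * (t - s)"
proof -
  have "emeasure M A = (\<integral>\<^sup>+x. indicator A x \<partial>M)" using assms by simp
  also have "\<dots> \<le> ennreal L * (\<integral>\<^sup>+x. indicator A x * indicator {a..b} x \<partial>lborel)"
    using assms by (intro nn_integral_le) auto
  also have "\<dots> \<le> ennreal L * (\<integral>\<^sup>+x. indicator {s..t} x \<partial>lborel)"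
    using assms by (intro mult_left_mono nn_integral_mono) (auto simp: indicator_def)
  also have "\<dots> = ennreal (L * (t - s))"
    using assms L_pos by (simp add: ennreal_mult)
  finally show ?thesis
    using assms L_pos by (simp add: emeasure_eq_measure)
qed

text \<open>The open interval in the hypothesis lets the bound apply alike to intervals of all four kinds.\<close>

lemma measure_ge_length:
  assumes "A \<in> sets borel" "{s<..<t} \<subseteq> A" "s \<le> t" "a \<le> s" "t \<le> b"
  shows "l * (t - s) \<le> measure M A"
proof -
  have "ennreal (l * (t - s)) = ennreal l * (\<integral>\<^sup>+x. indicator {s<..<t} x \<partial>lborel)"
    using assms l_pos by (simp add: ennreal_mult)
  also have "\<dots> \<le> ennreal l * (\<integral>\<^sup>+x. indicator A x * indicator {a..b} x \<partial>lborel)"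
    using assms by (intro mult_left_mono nn_integral_mono) (auto simp: indicator_def)
  also have "\<dots> \<le> (\<integral>\<^sup>+x. indicator A x \<partial>M)"
    using assms by (intro nn_integral_ge) auto
  also have "\<dots> = emeasure M A" using assms by simp
  finally show ?thesis
    by (simp add: emeasure_eq_measure)
qed

text \<open>The measure charges every subinterval, so a continuous function is determined by its values
  almost everywhere.\<close>

lemma continuous_AE_eq_const:
  fixes \<phi> :: "real \<Rightarrow> real"
  assumes cont: "continuous_on {a..b} \<phi>" and ae: "AE x in M. \<phi> x = c" and x: "x \<in> {a..b}"
  shows "\<phi> x = c"
proof (rule ccontr)
  assume "\<phi> x \<noteq> c"
  then obtain r where r: "r > 0" "\<And>y. y \<in> {a..b} \<Longrightarrow> \<bar>y - x\<bar> < r \<Longrightarrow> \<phi> y \<noteq> c"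
    using cont x unfolding continuous_on_iff
    by (metis dist_real_def dist_commute zero_less_dist_iff less_irrefl)
  define s t where "s = max a (x - r)" and "t = min b (x + r)"
  have st: "s < t" "a \<le> s" "t \<le> b" using r x a_less_b by (auto simp: s_def t_def)
  have "AE y in M. y \<notin> {s<..<t}"
    using ae
  proof eventually_elim
    case (elim y)
    have "\<bar>y - x\<bar> < r" if "y \<in> {s<..<t}" using that by (auto simp: s_def t_def)
    then show ?case using r(2)[of y] elim by (auto simp: s_def t_def)
  qed
  then have "measure M {s<..<t} = 0"
    by (subst (asm) AE_iff_measurable[where N = "{s<..<t}"]) (auto simp: measure_def)
  moreover have "l * (t - s) \<le> measure M {s<..<t}"
    using st by (intro measure_ge_length) auto
  ultimately show False using st l_pos by (simp add: mult_le_0_iff)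
qed

lemma cdf_diff_bounds:
  assumes "x \<le> y"
  shows "cdf M y - cdf M x \<le> L * (y - x)"
    and "a \<le> x \<Longrightarrow> y \<le> b \<Longrightarrow> l * (y - x) \<le> cdf M y - cdf M x"
proof -
  interpret real_distribution M by standard auto
  have eq: "cdf M y - cdf M x = measure M {x<..y}" if "x < y"
    using that by (simp add: cdf_diff_eq)
  show "cdf M y - cdf M x \<le> L * (y - x)"
    using assms eq measure_le_length[of "{x<..y}" x y] by (cases "x = y") (auto simp: subset_iff)
  show "l * (y - x) \<le> cdf M y - cdf M x" if "a \<le> x" "y \<le> b"
    using assms eq that measure_ge_length[of "{x<..y}" x y] by (cases "x = y") (auto simp: subset_iff)
qed

lemma cdf_endpoints: "x \<le> a \<Longrightarrow> cdf M x = 0" "b \<le> x \<Longrightarrow> cdf M x = 1"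
proof -
  show "cdf M x = 0" if "x \<le> a"
  proof -
    have "measure M {..x} \<le> L * (a - a)"
      using that by (intro measure_le_length) auto
    then show ?thesis
      using measure_nonneg[of M "{..x}"] by (simp add: cdf_def)
  qed
  show "cdf M x = 1" if "b \<le> x"
  proof -
    have "AE y in M. y \<in> {..x}"
      using AE_in_interval by eventually_elim (use that in auto)
    then show ?thesis by (simp add: cdf_def prob_eq_1)
  qed
qed

lemma cdf_Lipschitz: "\<bar>cdf M y - cdf M x\<bar> \<le> L * \<bar>y - x\<bar>"
  using cdf_diff_bounds(1)[of x y] cdf_diff_bounds(1)[of y x]
    finite_borel_measure.cdf_nondecreasing[of M x y] finite_borel_measure.cdf_nondecreasing[of M y x]
    L_pos
  by (cases "x \<le> y") (auto simp: finite_borel_measure_def finite_measure_axioms finite_borel_measure_axioms_def abs_if algebra_simps)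

lemma cdf_expansive:
  assumes "x \<in> {a..b}" "y \<in> {a..b}"
  shows "l * \<bar>y - x\<bar> \<le> \<bar>cdf M y - cdf M x\<bar>"
  using cdf_diff_bounds(2)[of x y] cdf_diff_bounds(2)[of y x] assms
  by (cases "x \<le> y") auto

lemma cdf_continuous: "continuous_on UNIV (cdf M)"
proof -
  have "L-lipschitz_on UNIV (cdf M)"
    using cdf_Lipschitz L_pos by (intro lipschitz_onI) (auto simp: dist_real_def)
  then show ?thesis by (rule lipschitz_on_continuous_on)
qed

lemma cdf_in_unit: "cdf M x \<in> {0..1}"
  by (auto simp: cdf_def)

lemma cdf_surj:
  assumes "p \<in> {0..1}"
  shows "p \<in> cdf M ` {a..b}"
  using IVT'[of "cdf M" a p b] assms a_less_b cdf_endpoints cdf_continuous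
  by (force intro: continuous_on_subset)

text \<open>The distribution function pushes the measure forward to the uniform distribution on the unit
interval.\<close>

lemma measure_cdf_less:
  assumes "p \<in> {0..1}"
  shows "measure M {y. cdf M y < p} = p"
proof -
  have [measurable]: "cdf M \<in> borel_measurable borel"
    using cdf_continuous by (rule borel_measurable_continuous_onI)
  obtain q where q: "q \<in> {a..b}" "p = cdf M q" using cdf_surj[OF assms] by auto
  have "measure M {q} \<le> L * (q - q)" by (rule measure_le_length) auto
  then have "measure M {q} = 0" using measure_nonneg[of M "{q}"] by simp
  then have "AE y in M. y \<noteq> q"
    by (subst AE_iff_measurable[where N="{q}"]) (auto simp: emeasure_eq_measure)
  with AE_in_interval have "AE y in M. y \<in> {y. cdf M y < p} \<longleftrightarrow> y \<in> {..q}"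
  proof eventually_elim
    case (elim y)
    have "l * \<bar>q - y\<bar> > 0" using elim l_pos by simp
    then have "cdf M y < cdf M q \<longleftrightarrow> y \<le> q"
      using elim q cdf_diff_bounds(2)[of y q] cdf_diff_bounds(2)[of q y] by (cases "y \<le> q") auto
    then show ?case using q by simp
  qed
  then have "measure M {y. cdf M y < p} = measure M {..q}"
    by (intro measure_eq_AE) auto
  then show ?thesis using q by (simp add: cdf_def)
qed

text \<open>The number \<open>s\<close> lies in exactly one of the \<open>n\<close> half-open blocks \<open>[k / n, (k + 1) / n)\<close>, and each block
of quantiles has mass \<open>1 / n\<close>.  At \<open>s = 1\<close> the block would start at \<open>1\<close> and be null.\<close>

lemma block_mass:
  assumes n: "0 < (n::nat)" and s: "0 \<le> s" "s < 1"
  shows "(\<integral>y. (if \<lfloor>real n * s\<rfloor> = \<lfloor>real n * cdf M y\<rfloor> then real n else 0) \<partial>M) = 1"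
proof -
  have [measurable]: "cdf M \<in> borel_measurable borel"
    using cdf_continuous by (rule borel_measurable_continuous_onI)
  define k where "k = \<lfloor>real n * s\<rfloor>"
  have "0 \<le> k" using s by (simp add: k_def)
  have "real n * s < real n * 1" using n s by (intro mult_strict_left_mono) auto
  then have kn: "k + 1 \<le> int n" 
    using floor_less_iff[of "real n * s" "int n"] by (simp add: k_def)
  let ?p = "real_of_int k / real n" and ?q = "(real_of_int k + 1) / real n"
  have pq: "?p \<in> {0..1}" "?q \<in> {0..1}" using n kn \<open>0 \<le> k\<close> by (auto simp: field_simps)
  have "\<lfloor>real n * s\<rfloor> = \<lfloor>real n * cdf M y\<rfloor> \<longleftrightarrow> y \<in> {y. cdf M y < ?q} - {y. cdf M y < ?p}" for y
    unfolding k_def[symmetric] using n by (subst eq_commute) (simp add: floor_eq_iff divide_le_eq less_divide_eq not_less mult.commute conj_commute)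
  then have "(\<integral>y. (if \<lfloor>real n * s\<rfloor> = \<lfloor>real n * cdf M y\<rfloor> then real n else 0) \<partial>M)
      = (\<integral>y. real n * indicator ({y. cdf M y < ?q} - {y. cdf M y < ?p}) y \<partial>M)"
    by (intro Bochner_Integration.integral_cong) (auto simp: indicator_def)
  also have "\<dots> = real n * measure M ({y. cdf M y < ?q} - {y. cdf M y < ?p})"
    by (subst integral_mult_right_zero) simp
  also have "measure M ({y. cdf M y < ?q} - {y. cdf M y < ?p}) = ?q - ?p"
  proof (subst finite_measure_Diff)
    have "?p \<le> ?q" by (simp add: divide_right_mono)
    then show "{y. cdf M y < ?p} \<subseteq> {y. cdf M y < ?q}" by auto
  qed (auto simp: measure_cdf_less[OF pq(1)] measure_cdf_less[OF pq(2)])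
  finally show ?thesis using n by (simp add: field_simps)
qed

lemma AE_cdf_less_1: "AE x in M. cdf M x < 1"
  using AE_prob_1[OF measure_cdf_less[of 1]] by simp

lemma integrable_indicator_borel [simp]:
  "A \<in> sets borel \<Longrightarrow> integrable M (indicator A :: real \<Rightarrow> real)"
  by (rule integrable_bounded[where B = 1]) auto

text \<open>Suppose \<open>k\<close> is nonnegative at \<open>z\<close>, at distance \<open>D\<close> from \<open>t\<close>.  If the set where \<open>k \<ge> 0\<close> stays away
from \<open>t\<close> the bound is immediate.  Otherwise that set has length of order \<open>D\<close>; by concavity \<open>k\<close> is
then at least half its maximum on an interval of length of order \<open>D\<close>, so its integral is at least twice
what a small neighbourhood of \<open>t\<close>, of radius \<open>\<kappa> * D\<close>, can carry.  Hence at least half of the mass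
lies at distance at least \<open>\<kappa> * D\<close> from \<open>t\<close>.\<close>

lemma concave_second_moment:
  fixes k :: "real \<Rightarrow> real" and t D :: real
  defines "\<kappa> \<equiv> 3 / 128 * (l / L)"
  assumes cont: "continuous_on UNIV k" and conc: "concave_on {a..b} k"
    and near: "\<And>y. y \<in> {a..b} \<Longrightarrow> 0 \<le> k y \<Longrightarrow> \<bar>y - t\<bar> \<le> D"
    and z: "z \<in> {a..b}" "0 \<le> k z" "\<bar>z - t\<bar> = D"
  shows "\<kappa>\<^sup>2 / 2 * D\<^sup>2 * (\<integral>y. max (k y) 0 \<partial>M) \<le> (\<integral>y. (y - t)\<^sup>2 * max (k y) 0 \<partial>M)"
proof -
  define I where "I = (\<integral>y. max (k y) 0 \<partial>M)"
  have \<kappa>: "0 < \<kappa>" "\<kappa> \<le> 3 / 128" 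
    using l_pos l_le_L L_pos divide_le_eq_1_pos[of L l] by (auto simp: \<kappa>_def simp del: divide_le_eq_1_pos)
  have I0: "0 \<le> I" unfolding I_def by (rule integral_nonneg_AE) auto
  have D0: "0 \<le> D" using z by auto
  have int: "integrable M (\<lambda>y. max (k y) 0)" "integrable M (\<lambda>y. (y - t)\<^sup>2 * max (k y) 0)"
    by (intro integrable_continuous continuous_intros cont)+
  show ?thesis
  proof (cases "\<forall>y\<in>{a..b}. 0 \<le> k y \<longrightarrow> D / 4 \<le> \<bar>y - t\<bar>")
    case True
    have "(\<integral>y. (D / 4)\<^sup>2 * max (k y) 0 \<partial>M) \<le> (\<integral>y. (y - t)\<^sup>2 * max (k y) 0 \<partial>M)"
    proof (intro integral_mono_interval int integrable_mult_right)
      fix y assume "y \<in> {a..b}"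
      then show "(D / 4)\<^sup>2 * max (k y) 0 \<le> (y - t)\<^sup>2 * max (k y) 0"
        using True D0 abs_le_square_iff[of "D / 4" "y - t"]
        by (cases "0 \<le> k y") (auto intro!: mult_right_mono)
    qed
    moreover have "\<kappa>\<^sup>2 / 2 * D\<^sup>2 * I \<le> (D / 4)\<^sup>2 * I"
    proof (intro mult_right_mono I0)
      have "\<kappa>\<^sup>2 \<le> (3 / 128)\<^sup>2" using \<kappa> by (intro power_mono) auto
      then have "\<kappa>\<^sup>2 / 2 * D\<^sup>2 \<le> 1 / 16 * D\<^sup>2" by (intro mult_right_mono) (auto simp: power2_eq_square)
      then show "\<kappa>\<^sup>2 / 2 * D\<^sup>2 \<le> (D / 4)\<^sup>2" by (simp add: power_divide)
    qed
    ultimately show ?thesis by (simp add: I_def)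
  next
    case False
    then obtain s where s: "s \<in> {a..b}" "0 \<le> k s" "\<bar>s - t\<bar> < D / 4" by (auto simp: not_le)
    have "\<exists>m\<in>{a..b}. \<forall>y\<in>{a..b}. k y \<le> k m"
      using a_less_b by (intro continuous_attains_sup continuous_on_subset[OF cont]) auto
    then obtain m where m: "m \<in> {a..b}" "\<And>y. y \<in> {a..b} \<Longrightarrow> k y \<le> k m" by blast
    have km: "0 \<le> k m" using m z by force
    \<comment> \<open>The points \<open>z\<close> and \<open>s\<close> are at least \<open>3 / 4 * D\<close> apart, so the maximum point \<open>m\<close> is far from one of them.\<close>
    obtain q where q: "q \<in> {a..b}" "0 \<le> k q" "3 / 8 * D \<le> \<bar>m - q\<bar>"
    proof (cases "3 / 8 * D \<le> \<bar>m - z\<bar>")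
      case True then show ?thesis using that z by blast
    next
      case False
      then have "3 / 8 * D \<le> \<bar>m - s\<bar>" using s z by linarith
      then show ?thesis using that s by blast
    qed
    define r where "r = (m + q) / 2"
    \<comment> \<open>Between \<open>m\<close> and the midpoint \<open>r\<close> the value \<open>k m\<close> has weight at least one half.\<close>
    have half: "k m / 2 \<le> k y" if y: "y \<in> {min m r..max m r}" for y
    proof (cases "m = q")
      case True
      then show ?thesis using y km by (simp add: r_def)
    next
      case False
      define w where "w = (y - m) / (q - m)"
      have w: "0 \<le> w" "w \<le> 1 / 2" "y = (1 - w) *\<^sub>R m + w *\<^sub>R q"
        using y False by (auto simp: w_def r_def min_def max_def divide_simps split: if_splits)
                         (auto simp: algebra_simps)
      have "(1 - w) * k m + w * k q \<le> k y"
        unfolding w(3) using w m q by (intro concave_onD[OF conc]) auto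
      moreover have "1 / 2 * k m \<le> (1 - w) * k m" using w km by (intro mult_right_mono) auto
      moreover have "0 \<le> w * k q" using w q by simp
      ultimately show ?thesis by linarith
    qed
    have sub: "a \<le> min m r" "max m r \<le> b" using m q by (auto simp: r_def)
    have "k m / 2 * (l * (max m r - min m r)) \<le> k m / 2 * measure M {min m r..max m r}"
      using sub km by (intro mult_left_mono measure_ge_length) auto
    also have "\<dots> = (\<integral>y. k m / 2 * indicator {min m r..max m r} y \<partial>M)"
      by simp
    also have "\<dots> \<le> I"
      unfolding I_def
    proof (intro integral_mono int)
      show "k m / 2 * indicator {min m r..max m r} y \<le> max (k y) 0" for y
        using half[of y] by (simp split: split_indicator) linarith
    qed (rule integrable_mult_right, simp)
    finally have "k m / 2 * (l * (max m r - min m r)) \<le> I" .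
    moreover have "max m r - min m r = \<bar>m - q\<bar> / 2"
      by (auto simp: r_def max_def min_def abs_if field_simps)
    then have "k m / 2 * (l * (3 / 16 * D)) \<le> k m / 2 * (l * (max m r - min m r))"
      using q km l_pos by (intro mult_left_mono) auto
    ultimately have "k m / 2 * (l * (3 / 16 * D)) \<le> I" by linarith
    then have I_ge: "3 / 32 * (k m * (l * D)) \<le> I" by (simp add: mult_ac)
    \<comment> \<open>The value of \<open>\<kappa>\<close> is chosen so that at most half of the integral comes from \<open>B\<close>.\<close>
    define B where "B = {t - \<kappa> * D<..<t + \<kappa> * D}"
    have "measure M B \<le> L * ((t + \<kappa> * D) - (t - \<kappa> * D))"
      unfolding B_def using \<kappa> D0 by (intro measure_le_length) auto
    also have "\<dots> = 3 / 64 * (l * D)" using L_pos by (simp add: \<kappa>_def)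
    finally have "k m * measure M B \<le> k m * (3 / 64 * (l * D))" using km by (intro mult_left_mono) auto
    then have bad: "k m * measure M B \<le> I / 2" using I_ge by (simp add: algebra_simps)
    have intB: "integrable M (\<lambda>y. (\<kappa> * D)\<^sup>2 * (max (k y) 0 - k m * indicator B y))"
      using int(1) by (intro integrable_mult_right Bochner_Integration.integrable_diff) (auto simp: B_def)
    have "(\<integral>y. (\<kappa> * D)\<^sup>2 * (max (k y) 0 - k m * indicator B y) \<partial>M) \<le> (\<integral>y. (y - t)\<^sup>2 * max (k y) 0 \<partial>M)"
    proof (intro integral_mono_interval int intB)
      fix y assume y: "y \<in> {a..b}"
      show "(\<kappa> * D)\<^sup>2 * (max (k y) 0 - k m * indicator B y) \<le> (y - t)\<^sup>2 * max (k y) 0"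
      proof (cases "y \<in> B")
        case True
        have "(\<kappa> * D)\<^sup>2 * (max (k y) 0 - k m * indicator B y) \<le> 0"
          using m(2)[OF y] km True by (intro mult_nonneg_nonpos) auto
        also have "0 \<le> (y - t)\<^sup>2 * max (k y) 0" by simp
        finally show ?thesis .
      next
        case False
        then have "\<bar>\<kappa> * D\<bar> \<le> \<bar>y - t\<bar>" using \<kappa> D0 by (auto simp: B_def)
        then have "(\<kappa> * D)\<^sup>2 \<le> (y - t)\<^sup>2" by (simp add: abs_le_square_iff)
        then show ?thesis using False by (simp add: mult_right_mono)
      qed
    qed
    also have "(\<integral>y. (\<kappa> * D)\<^sup>2 * (max (k y) 0 - k m * indicator B y) \<partial>M)
        = (\<kappa> * D)\<^sup>2 * (I - k m * measure M B)"
      using int(1) by (simp add: I_def B_def)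
    finally have "(\<kappa> * D)\<^sup>2 * (I - k m * measure M B) \<le> (\<integral>y. (y - t)\<^sup>2 * max (k y) 0 \<partial>M)" .
    moreover have "(\<kappa> * D)\<^sup>2 * (I / 2) \<le> (\<kappa> * D)\<^sup>2 * (I - k m * measure M B)"
      using bad by (intro mult_left_mono) auto
    ultimately show ?thesis by (simp add: I_def power_mult_distrib)
  qed
qed

lemma L2_norm_comparison:
  assumes [measurable]: "h \<in> borel_measurable borel" and B: "\<And>x. x \<in> {a..b} \<Longrightarrow> \<bar>h x\<bar> \<le> B"
  shows "square_integrable_on {a..b} h"
    and "sqrt l * L2_norm_on {a..b} h \<le> sqrt (\<integral>x. (h x)\<^sup>2 \<partial>M)"
    and "sqrt (\<integral>x. (h x)\<^sup>2 \<partial>M) \<le> sqrt L * L2_norm_on {a..b} h"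
proof -
  have "0 \<le> (h x)\<^sup>2 \<and> (h x)\<^sup>2 \<le> B\<^sup>2" if "x \<in> {a..b}" for x
    using power_mono[OF B[OF that], of 2] by simp
  note cmp = lebesgue_integral_comparison[OF _ this]
  show "square_integrable_on {a..b} h"
    unfolding square_integrable_on_def set_borel_measurable_def using cmp(1) by simp
  show "sqrt l * L2_norm_on {a..b} h \<le> sqrt (\<integral>x. (h x)\<^sup>2 \<partial>M)"
    "sqrt (\<integral>x. (h x)\<^sup>2 \<partial>M) \<le> sqrt L * L2_norm_on {a..b} h"
    unfolding L2_norm_on_def real_sqrt_mult[symmetric] using cmp(2,3) by simp_all
qed

end

section \<open>One marginal equation\<close>

definition slack :: "(real \<Rightarrow> real) \<Rightarrow> (real \<Rightarrow> real) \<Rightarrow> real \<Rightarrow> real \<Rightarrow> real" where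
  "slack f g x y = x * y - f x - g y"

text \<open>Half of the hypotheses on a pair of potentials: the equation in which the second variable is
integrated out.  The other half is an instance of the same locale with \<open>f\<close> and \<open>g\<close> exchanged, so
everything proved here applies to both potentials.\<close>

locale marginal_equation = interval_density N c d l L v
  for N c d l L v +
  fixes a b :: real and f g :: "real \<Rightarrow> real" and \<epsilon> :: real
  assumes cont_f: "continuous_on UNIV f" and cont_g: "continuous_on UNIV g"
    and \<epsilon>_pos: "0 < \<epsilon>"
    and marginal: "\<And>x. x \<in> {a..b} \<Longrightarrow> (\<integral>y. max (slack f g x y) 0 \<partial>N) = \<epsilon>"
begin

abbreviation S :: "real \<Rightarrow> real set" where "S \<equiv> support_section {c..d} f g"

definition barycenter :: "real \<Rightarrow> real" where
  "barycenter x = (\<integral>y. indicator (S x) y * y \<partial>N) / measure N (S x)"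

lemma slack_continuous [continuous_intros]:
  "continuous_on UNIV \<phi> \<Longrightarrow> continuous_on UNIV \<psi> \<Longrightarrow> continuous_on UNIV (\<lambda>z. slack f g (\<phi> z) (\<psi> z))"
  unfolding slack_def
  by (intro continuous_intros continuous_on_compose2[OF cont_f] continuous_on_compose2[OF cont_g]) auto

lemma S_eq: "S x = {c..d} \<inter> {y. 0 \<le> slack f g x y}"
  by (auto simp: support_section_def slack_def)

lemma S_closed: "closed (S x)"
  unfolding S_eq
  by (intro closed_Int closed_Collect_le continuous_intros slack_continuous)

lemma S_measurable [measurable]: "S x \<in> sets borel"
  using S_closed by auto

lemma integrable_pos_slack: "integrable N (\<lambda>y. max (slack f g x y) 0)"
  by (intro integrable_continuous continuous_intros slack_continuous)

lemma integrable_indicator_S: "continuous_on UNIV \<phi> \<Longrightarrow> integrable N (\<lambda>y. indicator (S x) y * \<phi> y)"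
  for \<phi> :: "real \<Rightarrow> real"
  using integrable_real_mult_indicator[OF _ integrable_continuous, of "S x" \<phi>]
  by (simp add: mult.commute)

lemma measure_S_pos:
  assumes "x \<in> {a..b}" shows "0 < measure N (S x)"
proof (rule ccontr)
  assume "\<not> 0 < measure N (S x)"
  then have "measure N (S x) = 0" using measure_nonneg[of N "S x"] by linarith
  then have "AE y in N. y \<notin> S x"
    by (subst AE_iff_measurable[OF _ refl]) (auto simp: emeasure_eq_measure)
  then have "AE y in N. max (slack f g x y) 0 = 0"
    using AE_in_interval by eventually_elim (auto simp: S_eq)
  then have "(\<integral>y. max (slack f g x y) 0 \<partial>N) = 0" by (rule integral_eq_zero_AE)
  then show False using marginal[OF assms] \<epsilon>_pos by simp
qed

lemma exists_slack_pos:
  assumes "x \<in> {a..b}" obtains y where "y \<in> {c..d}" "0 < slack f g x y"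
proof -
  have "\<exists>y\<in>{c..d}. 0 < slack f g x y"
  proof (rule ccontr)
    assume "\<not> ?thesis"
    then have "(\<integral>y. max (slack f g x y) 0 \<partial>N) \<le> (\<integral>y. 0 \<partial>N)"
      by (intro integral_mono_interval integrable_pos_slack) (auto simp: not_less)
    then show False using marginal[OF assms] \<epsilon>_pos by simp
  qed
  then show ?thesis using that by blast
qed

text \<open>On \<open>S x\<close> the positive part at \<open>x'\<close> exceeds the one at \<open>x\<close> by at least
\<open>slack f g x' y - slack f g x y = (x' - x) * y - (f x' - f x)\<close>, and outside \<open>S x\<close> it cannot
decrease.  Both positive parts have the same integral, so the integral of this difference over
\<open>S x\<close> is at most zero.\<close>

lemma barycenter_subgradient:
  assumes "x \<in> {a..b}" "x' \<in> {a..b}"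
  shows "f x + (x' - x) * barycenter x \<le> f x'"
proof -
  let ?I = "indicator (S x) :: real \<Rightarrow> real"
  have le: "(\<integral>y. ?I y * ((x' - x) * y - (f x' - f x)) \<partial>N)
      \<le> (\<integral>y. max (slack f g x' y) 0 - max (slack f g x y) 0 \<partial>N)"
    by (intro integral_mono_interval Bochner_Integration.integrable_diff
          integrable_pos_slack integrable_indicator_S continuous_intros)
       (auto simp: S_eq indicator_def slack_def algebra_simps max_def)
  have "(\<integral>y. ?I y * ((x' - x) * y - (f x' - f x)) \<partial>N)
      = (\<integral>y. (x' - x) * (?I y * y) - (f x' - f x) * ?I y \<partial>N)"
    by (simp add: algebra_simps)
  also have "\<dots> = (x' - x) * (\<integral>y. ?I y * y \<partial>N) - (f x' - f x) * measure N (S x)"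
    using integrable_indicator_S[of "\<lambda>y. y" x] integrable_indicator_S[of "\<lambda>y. 1" x]
    by (subst Bochner_Integration.integral_diff) (auto intro!: continuous_intros)
  finally have "(x' - x) * (\<integral>y. ?I y * y \<partial>N) \<le> (f x' - f x) * measure N (S x)"
    using le marginal[OF assms(1)] marginal[OF assms(2)]
    by (simp add: Bochner_Integration.integral_diff integrable_pos_slack)
  then have "(x' - x) * barycenter x \<le> f x' - f x"
    using measure_S_pos[OF assms(1)] by (simp add: barycenter_def pos_divide_le_eq)
  then show ?thesis by simp
qed

lemma f_convex: "convex_on {a..b} f"
  by (rule convex_on_if_subgradients[where m = barycenter]) (auto intro: barycenter_subgradient)

lemma barycenter_near:
  assumes "x \<in> {a..b}" and D: "\<And>y. y \<in> S x \<Longrightarrow> \<bar>y - t\<bar> \<le> D"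
  shows "\<bar>barycenter x - t\<bar> \<le> D"
proof -
  let ?I = "indicator (S x) :: real \<Rightarrow> real"
  have int: "integrable N (\<lambda>y. ?I y * y)" "integrable N ?I"
    using integrable_indicator_S[of "\<lambda>y. y" x] integrable_indicator_S[of "\<lambda>y. 1" x]
    by (auto intro!: continuous_intros)
  have "(\<integral>y. ?I y * y \<partial>N) \<le> (\<integral>y. (t + D) * ?I y \<partial>N)"
    using int D by (intro integral_mono integrable_mult_right) (fastforce simp: abs_le_iff split: split_indicator)+
  moreover have "(\<integral>y. (t - D) * ?I y \<partial>N) \<le> (\<integral>y. ?I y * y \<partial>N)"
    using int D by (intro integral_mono integrable_mult_right) (fastforce simp: abs_le_iff split: split_indicator)+
  ultimately have "(\<integral>y. ?I y * y \<partial>N) \<le> (t + D) * measure N (S x)"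
    "(t - D) * measure N (S x) \<le> (\<integral>y. ?I y * y \<partial>N)"
    by (simp_all del: indicator_simps)
  then have "barycenter x \<le> t + D" "t - D \<le> barycenter x"
    using measure_S_pos[OF assms(1)] by (auto simp: barycenter_def divide_simps)
  then show ?thesis by auto
qed

text \<open>By convexity of \<open>g\<close> the slack, being positive somewhere, has finitely many zeros.  Their being null
is what makes integrals over \<open>S x\<close> continuous in \<open>x\<close>: whether \<open>y\<close> belongs to \<open>S x\<close> can change
abruptly only where the slack is zero.\<close>

lemma AE_slack_nonzero:
  assumes "convex_on {c..d} g" "x \<in> {a..b}"
  shows "AE y in N. slack f g x y \<noteq> 0"
proof -
  obtain z where z: "z \<in> {c..d}" "0 < slack f g x z" using exists_slack_pos assms(2) .
  have "convex_on {c..d} (\<lambda>y. g y + (- x * y + f x))"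
  proof (rule convex_on_add[OF assms(1)])
    show "convex_on {c..d} (\<lambda>y. - x * y + f x)"
      by (rule convex_onI) (auto simp: algebra_simps)
  qed
  moreover have "(\<lambda>y. g y + (- x * y + f x)) = (\<lambda>y. - slack f g x y)"
    by (auto simp: slack_def)
  ultimately have "finite {y \<in> {c..d}. - slack f g x y = 0}"
    using z by (intro convex_on_zeros_finite) auto
  moreover have "AE y in N. y \<noteq> s" for s
    using measure_le_length[of "{s}" s s] measure_nonneg[of N "{s}"]
    by (subst AE_iff_measurable[where N="{s}"]) (auto simp: emeasure_eq_measure)
  ultimately have "AE y in N. \<forall>s\<in>{y \<in> {c..d}. - slack f g x y = 0}. y \<noteq> s"
    by (intro AE_finite_allI) auto
  then show ?thesis
    using AE_in_interval by eventually_elim auto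
qed

lemma integral_S_continuous:
  fixes \<phi> :: "real \<Rightarrow> real"
  assumes conv: "convex_on {c..d} g" and \<phi>: "continuous_on UNIV \<phi>"
  shows "continuous_on {a..b} (\<lambda>x. \<integral>y. indicator (S x) y * \<phi> y \<partial>N)"
  unfolding continuous_on_sequentially comp_def
proof safe
  fix X and x assume x: "x \<in> {a..b}" and X: "\<forall>n::nat. X n \<in> {a..b}" and lim: "X \<longlonglongrightarrow> x"
  have [measurable]: "\<phi> \<in> borel_measurable borel" using \<phi> by (rule borel_measurable_continuous_onI)
  show "(\<lambda>n. \<integral>y. indicator (S (X n)) y * \<phi> y \<partial>N) \<longlonglongrightarrow> (\<integral>y. indicator (S x) y * \<phi> y \<partial>N)"
  proof (rule integral_dominated_convergence[where w="\<lambda>y. \<bar>\<phi> y\<bar>"])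
    show "AE y in N. (\<lambda>n. indicator (S (X n)) y * \<phi> y) \<longlonglongrightarrow> indicator (S x) y * \<phi> y"
      using AE_slack_nonzero[OF conv x] AE_in_interval
    proof eventually_elim
      case (elim y)
      have cont: "continuous_on UNIV (\<lambda>x. slack f g x y)" by (intro slack_continuous continuous_intros)
      have sl: "(\<lambda>n. slack f g (X n) y) \<longlonglongrightarrow> slack f g x y"
        by (rule continuous_on_tendsto_compose[OF cont lim]) auto
      have "\<forall>\<^sub>F n in sequentially. indicator (S x) y * \<phi> y = indicator (S (X n)) y * \<phi> y"
      proof (cases "0 < slack f g x y")
        case True
        show ?thesis using order_tendstoD(1)[OF sl True]
          by eventually_elim (use True elim in \<open>auto simp: S_eq indicator_def\<close>)
      next
        case False
        then have "slack f g x y < 0" using elim by auto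
        from order_tendstoD(2)[OF sl this] show ?thesis
          by eventually_elim (use False elim in \<open>auto simp: S_eq indicator_def\<close>)
      qed
      then show ?case using Lim_transform_eventually[OF tendsto_const] by fast
    qed
  qed (auto intro!: integrable_continuous continuous_intros \<phi> simp: indicator_def)
qed

lemma barycenter_continuous:
  assumes "convex_on {c..d} g"
  shows "continuous_on {a..b} barycenter"
proof -
  have "continuous_on {a..b} (\<lambda>x. (\<integral>y. indicator (S x) y * y \<partial>N) / (\<integral>y. indicator (S x) y * 1 \<partial>N))"
    using measure_S_pos by (intro continuous_intros integral_S_continuous assms) force
  then show ?thesis by (simp add: barycenter_def[abs_def])
qed

text \<open>The difference quotient lies between the subgradients at the two points, and these are close by
continuity of the barycenter.\<close>

lemma f_has_derivative:
  assumes "convex_on {c..d} g" "x \<in> {a..b}"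
  shows "(f has_real_derivative barycenter x) (at x within {a..b})"
proof -
  have lim: "((\<lambda>y. \<bar>barycenter y - barycenter x\<bar>) \<longlongrightarrow> 0) (at x within {a..b})"
    using barycenter_continuous[OF assms(1)] assms(2)
    by (auto simp: continuous_on_def intro!: tendsto_rabs_zero Lim_null[THEN iffD1])
  have "((\<lambda>y. (f y - f x) / (y - x) - barycenter x) \<longlongrightarrow> 0) (at x within {a..b})"
  proof (rule Lim_null_comparison[OF _ lim])
    show "\<forall>\<^sub>F y in at x within {a..b}. norm ((f y - f x) / (y - x) - barycenter x) \<le> \<bar>barycenter y - barycenter x\<bar>"
      unfolding eventually_at_filter
    proof (rule always_eventually, intro allI impI)
      fix y assume y: "y \<noteq> x" "y \<in> {a..b}"
      have 1: "(y - x) * barycenter x \<le> f y - f x"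
        and 2: "f y - f x \<le> (y - x) * barycenter y"
        using barycenter_subgradient[of x y] barycenter_subgradient[of y x] y assms
        by (auto simp: algebra_simps)
      have "\<bar>(f y - f x) - (y - x) * barycenter x\<bar> \<le> \<bar>(y - x) * (barycenter y - barycenter x)\<bar>"
        using 1 2 by (auto simp: algebra_simps)
      moreover have "((f y - f x) / (y - x) - barycenter x) * (y - x) = (f y - f x) - (y - x) * barycenter x"
        using y by (subst left_diff_distrib) (simp add: mult.commute)
      ultimately have "\<bar>((f y - f x) / (y - x) - barycenter x) * (y - x)\<bar> \<le> \<bar>barycenter y - barycenter x\<bar> * \<bar>y - x\<bar>"
        by (simp add: abs_mult mult.commute)
      then show "norm ((f y - f x) / (y - x) - barycenter x) \<le> \<bar>barycenter y - barycenter x\<bar>"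
        using y by (simp add: abs_mult)
    qed
  qed
  then show ?thesis
    unfolding has_field_derivative_iff by (rule Lim_null[THEN iffD2])
qed

end

section \<open>The monotone transport map and plans with bounded density\<close>

text \<open>Both measures share the bounds \<open>l\<close> and \<open>L\<close>, and the locale is symmetric under exchanging them.  The
inverse \<open>R\<close> of the transport map \<open>T\<close> is the transport map of the exchanged instance.\<close>

locale two_densities =
  X: interval_density M\<^sub>0 a\<^sub>0 b\<^sub>0 l L u\<^sub>0 + Y: interval_density M\<^sub>1 a\<^sub>1 b\<^sub>1 l L u\<^sub>1
  for M\<^sub>0 a\<^sub>0 b\<^sub>0 u\<^sub>0 M\<^sub>1 a\<^sub>1 b\<^sub>1 u\<^sub>1 l L
begin

sublocale P: pair_prob_space M\<^sub>0 M\<^sub>1 ..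

abbreviation T :: "real \<Rightarrow> real" where "T \<equiv> monge_map {a\<^sub>1..b\<^sub>1} M\<^sub>0 M\<^sub>1"
abbreviation R :: "real \<Rightarrow> real" where "R \<equiv> monge_map {a\<^sub>0..b\<^sub>0} M\<^sub>1 M\<^sub>0"

lemma T_in: "T x \<in> {a\<^sub>1..b\<^sub>1}" and cdf_T: "cdf M\<^sub>1 (T x) = cdf M\<^sub>0 x"
proof -
  have "cdf M\<^sub>0 x \<in> cdf M\<^sub>1 ` {a\<^sub>1..b\<^sub>1}" using Y.cdf_surj X.cdf_in_unit by blast
  then show "T x \<in> {a\<^sub>1..b\<^sub>1}" "cdf M\<^sub>1 (T x) = cdf M\<^sub>0 x"
    unfolding monge_map_def by (rule inv_into_into, rule f_inv_into_f)
qed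

lemma T_Lipschitz: "l * \<bar>T x' - T x\<bar> \<le> L * \<bar>x' - x\<bar>"
  using Y.cdf_expansive[OF T_in T_in, of x x'] X.cdf_Lipschitz[of x x'] by (simp add: cdf_T abs_minus_commute)

lemma T_expansive: "x \<in> {a\<^sub>0..b\<^sub>0} \<Longrightarrow> x' \<in> {a\<^sub>0..b\<^sub>0} \<Longrightarrow> l * \<bar>x' - x\<bar> \<le> L * \<bar>T x' - T x\<bar>"
  using X.cdf_expansive[of x x'] Y.cdf_Lipschitz[of "T x'" "T x"] by (simp add: cdf_T)

lemma T_continuous: "continuous_on UNIV T"
proof -
  have "(L / l)-lipschitz_on UNIV T"
    using T_Lipschitz X.l_pos X.L_pos by (intro lipschitz_onI) (auto simp: dist_real_def field_simps)
  then show ?thesis by (rule lipschitz_on_continuous_on)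
qed

lemma T_measurable [measurable]: "T \<in> borel_measurable borel"
  using T_continuous by (rule borel_measurable_continuous_onI)

lemma T_close_cdf: "y \<in> {a\<^sub>1..b\<^sub>1} \<Longrightarrow> l * \<bar>y - T x\<bar> \<le> \<bar>cdf M\<^sub>1 y - cdf M\<^sub>0 x\<bar>"
  using Y.cdf_expansive[OF T_in, of y x] by (simp add: cdf_T)

lemma swapped: "two_densities M\<^sub>1 a\<^sub>1 b\<^sub>1 u\<^sub>1 M\<^sub>0 a\<^sub>0 b\<^sub>0 u\<^sub>0 l L"
  by unfold_locales

lemmas R_in = two_densities.T_in[OF swapped]
  and cdf_R = two_densities.cdf_T[OF swapped]
  and R_Lipschitz = two_densities.T_Lipschitz[OF swapped]
  and R_expansive = two_densities.T_expansive[OF swapped]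
  and R_continuous = two_densities.T_continuous[OF swapped]

lemma R_T: "x \<in> {a\<^sub>0..b\<^sub>0} \<Longrightarrow> R (T x) = x"
  using X.cdf_expansive[OF _ R_in, of x "T x"] X.l_pos by (simp add: cdf_R cdf_T mult_le_0_iff)

lemma T_R: "y \<in> {a\<^sub>1..b\<^sub>1} \<Longrightarrow> T (R y) = y"
  using T_close_cdf[of y "R y"] X.l_pos by (simp add: cdf_R mult_le_0_iff)

lemma R_mono:
  assumes "y \<le> y'" shows "R y \<le> R y'"
proof (rule ccontr)
  assume "\<not> R y \<le> R y'"
  then have "l * (R y - R y') \<le> cdf M\<^sub>0 (R y) - cdf M\<^sub>0 (R y')"
    using R_in[of y] R_in[of y'] by (intro X.cdf_diff_bounds) auto
  also have "\<dots> \<le> 0" using assms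
    by (simp add: cdf_R finite_borel_measure.cdf_nondecreasing finite_borel_measure_def
        finite_borel_measure_axioms_def Y.finite_measure_axioms)
  finally show False using \<open>\<not> R y \<le> R y'\<close> X.l_pos by (simp add: mult_le_0_iff)
qed

text \<open>The potential \<open>G\<close> is an antiderivative of the inverse map \<open>R\<close>, extended to the whole line as a
constant on each side.  As \<open>x = R (T x)\<close>, the middle expression is the error of the tangent line of
\<open>G\<close> at \<open>T x\<close>, and the slopes of \<open>R\<close> lie between \<open>l / L\<close> and \<open>L / l\<close>.  It is also the duality gap of
the quadratic transport problem: it differs from \<open>- x * y\<close> by a function of \<open>x\<close> plus a function of \<open>y\<close>.\<close>

lemma convex_potential_exists:
  obtains G where "continuous_on UNIV G"
    "\<And>x y. x \<in> {a\<^sub>0..b\<^sub>0} \<Longrightarrow> y \<in> {a\<^sub>1..b\<^sub>1} \<Longrightarrow>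
      l / (2 * L) * (y - T x)\<^sup>2 \<le> G y - G (T x) - x * (y - T x) \<and>
      G y - G (T x) - x * (y - T x) \<le> L / (2 * l) * (y - T x)\<^sup>2"
proof -
  define G\<^sub>1 where "G\<^sub>1 y = integral {a\<^sub>1..y} R" for y
  define G where "G y = G\<^sub>1 (max a\<^sub>1 (min b\<^sub>1 y))" for y
  have der\<^sub>1: "(G\<^sub>1 has_real_derivative R y) (at y within {a\<^sub>1..b\<^sub>1})" if "y \<in> {a\<^sub>1..b\<^sub>1}" for y
    unfolding G\<^sub>1_def using that R_continuous
    by (intro integral_has_real_derivative) (auto intro: continuous_on_subset)
  have der: "(G has_real_derivative R y) (at y within {a\<^sub>1..b\<^sub>1})" if "y \<in> {a\<^sub>1..b\<^sub>1}" for y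
    by (rule has_field_derivative_transform_within[OF der\<^sub>1[OF that] zero_less_one that])
       (auto simp: G_def)
  have contG\<^sub>1: "continuous_on {a\<^sub>1..b\<^sub>1} G\<^sub>1"
    using der\<^sub>1 by (meson DERIV_continuous continuous_on_eq_continuous_within)
  have cont: "continuous_on UNIV G"
    unfolding G_def
    by (rule continuous_on_compose2[OF contG\<^sub>1]) (use Y.a_less_b in \<open>auto intro!: continuous_intros\<close>)
  have R1: "l / L * (s' - s) \<le> R s' - R s" and R2: "- (L / l) * (s' - s) \<le> - R s' - - R s"
    if "s \<in> {a\<^sub>1..b\<^sub>1}" "s' \<in> {a\<^sub>1..b\<^sub>1}" "s \<le> s'" for s s'
    using R_expansive[OF that(1,2)] R_Lipschitz[of s' s] R_mono[OF that(3)] that(3) X.L_pos X.l_pos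
    by (auto simp: field_simps)
  show ?thesis
  proof (rule that[OF cont])
    fix x y assume x: "x \<in> {a\<^sub>0..b\<^sub>0}" and y: "y \<in> {a\<^sub>1..b\<^sub>1}"
    have "l / L / 2 * (y - T x)\<^sup>2 \<le> G y - G (T x) - R (T x) * (y - T x)"
      by (rule derivative_expansive_imp_quadratic_growth[OF der R1 T_in y])
    moreover have "- (L / l) / 2 * (y - T x)\<^sup>2 \<le> - G y - - G (T x) - (- R (T x)) * (y - T x)"
      by (rule derivative_expansive_imp_quadratic_growth[OF _ R2 T_in y]) (auto intro!: derivative_eq_intros der)
    ultimately show "l / (2 * L) * (y - T x)\<^sup>2 \<le> G y - G (T x) - x * (y - T x) \<and>
      G y - G (T x) - x * (y - T x) \<le> L / (2 * l) * (y - T x)\<^sup>2"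
      by (simp add: R_T[OF x] mult.commute)
  qed
qed

lemma AE_in_rectangle: "AE p in M\<^sub>0 \<Otimes>\<^sub>M M\<^sub>1. fst p \<in> {a\<^sub>0..b\<^sub>0} \<and> snd p \<in> {a\<^sub>1..b\<^sub>1}"
proof (rule P.AE_pair_measure)
  show "AE x in M\<^sub>0. AE y in M\<^sub>1. fst (x, y) \<in> {a\<^sub>0..b\<^sub>0} \<and> snd (x, y) \<in> {a\<^sub>1..b\<^sub>1}"
    using X.AE_in_interval by eventually_elim (use Y.AE_in_interval in auto)
qed measurable

lemma integrable_prod_bounded:
  fixes k :: "real \<times> real \<Rightarrow> real"
  assumes [measurable]: "k \<in> borel_measurable (borel \<Otimes>\<^sub>M borel)"
    and "\<And>x y. x \<in> {a\<^sub>0..b\<^sub>0} \<Longrightarrow> y \<in> {a\<^sub>1..b\<^sub>1} \<Longrightarrow> \<bar>k (x, y)\<bar> \<le> B"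
  shows "integrable (M\<^sub>0 \<Otimes>\<^sub>M M\<^sub>1) k"
proof (rule P.P.integrable_const_bound[of _ B])
  show "AE p in M\<^sub>0 \<Otimes>\<^sub>M M\<^sub>1. norm (k p) \<le> B"
    using AE_in_rectangle by eventually_elim (use assms(2) in auto)
qed measurable

text \<open>
  Couplings of \<open>M\<^sub>0\<close> and \<open>M\<^sub>1\<close> with a bounded density.  The marginal conditions are imposed only almost
  everywhere, as the block densities below violate them at the right end points.
\<close>

definition plan_density :: "(real \<times> real \<Rightarrow> real) \<Rightarrow> bool" where
  "plan_density k \<longleftrightarrow> k \<in> borel_measurable (borel \<Otimes>\<^sub>M borel) \<and>
     (\<forall>p. 0 \<le> k p) \<and> (\<exists>B. \<forall>x\<in>{a\<^sub>0..b\<^sub>0}. \<forall>y\<in>{a\<^sub>1..b\<^sub>1}. k (x, y) \<le> B) \<and>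
     (AE x in M\<^sub>0. (\<integral>y. k (x, y) \<partial>M\<^sub>1) = 1) \<and> (AE y in M\<^sub>1. (\<integral>x. k (x, y) \<partial>M\<^sub>0) = 1)"

lemma integrable_times_plan:
  fixes \<phi> :: "real \<times> real \<Rightarrow> real"
  assumes "plan_density k" "continuous_on UNIV \<phi>"
  shows "integrable (M\<^sub>0 \<Otimes>\<^sub>M M\<^sub>1) (\<lambda>p. \<phi> p * k p)" "integrable (M\<^sub>0 \<Otimes>\<^sub>M M\<^sub>1) (\<lambda>p. (k p)\<^sup>2)"
proof -
  have [measurable]: "k \<in> borel_measurable (borel \<Otimes>\<^sub>M borel)" using assms by (simp add: plan_density_def)
  have [measurable]: "\<phi> \<in> borel_measurable (borel \<Otimes>\<^sub>M borel)"
    unfolding borel_prod using assms(2) by (rule borel_measurable_continuous_onI)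
  obtain B where k: "\<And>x y. x \<in> {a\<^sub>0..b\<^sub>0} \<Longrightarrow> y \<in> {a\<^sub>1..b\<^sub>1} \<Longrightarrow> 0 \<le> k (x, y) \<and> k (x, y) \<le> B"
    using assms(1) unfolding plan_density_def by blast
  have "compact (\<phi> ` ({a\<^sub>0..b\<^sub>0} \<times> {a\<^sub>1..b\<^sub>1}))"
    using assms(2) by (intro compact_continuous_image compact_Times) (auto intro: continuous_on_subset)
  then obtain B' where \<phi>: "\<And>x y. x \<in> {a\<^sub>0..b\<^sub>0} \<Longrightarrow> y \<in> {a\<^sub>1..b\<^sub>1} \<Longrightarrow> \<bar>\<phi> (x, y)\<bar> \<le> B'"
    using compact_imp_bounded[of "\<phi> ` ({a\<^sub>0..b\<^sub>0} \<times> {a\<^sub>1..b\<^sub>1})"] unfolding bounded_iff by force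
  show "integrable (M\<^sub>0 \<Otimes>\<^sub>M M\<^sub>1) (\<lambda>p. \<phi> p * k p)"
  proof (rule integrable_prod_bounded)
    fix x y assume "x \<in> {a\<^sub>0..b\<^sub>0}" "y \<in> {a\<^sub>1..b\<^sub>1}"
    then show "\<bar>\<phi> (x, y) * k (x, y)\<bar> \<le> B' * B"
      using k[of x y] \<phi>[of x y] unfolding abs_mult
      by (intro mult_mono order_trans[OF abs_ge_zero \<phi>]) auto
  qed measurable
  show "integrable (M\<^sub>0 \<Otimes>\<^sub>M M\<^sub>1) (\<lambda>p. (k p)\<^sup>2)"
  proof (rule integrable_prod_bounded)
    fix x y assume "x \<in> {a\<^sub>0..b\<^sub>0}" "y \<in> {a\<^sub>1..b\<^sub>1}"
    then show "\<bar>(k (x, y))\<^sup>2\<bar> \<le> B\<^sup>2" using k by (simp add: power_mono)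
  qed measurable
qed

lemma plan_marginals:
  fixes \<phi> \<psi> :: "real \<Rightarrow> real"
  assumes k: "plan_density k" and \<phi>: "continuous_on UNIV \<phi>" and \<psi>: "continuous_on UNIV \<psi>"
  shows "(\<integral>p. (\<phi> (fst p) + \<psi> (snd p)) * k p \<partial>(M\<^sub>0 \<Otimes>\<^sub>M M\<^sub>1)) = (\<integral>x. \<phi> x \<partial>M\<^sub>0) + (\<integral>y. \<psi> y \<partial>M\<^sub>1)"
proof -
  have [measurable]: "k \<in> borel_measurable (borel \<Otimes>\<^sub>M borel)" using assms by (simp add: plan_density_def)
  have [measurable]: "\<phi> \<in> borel_measurable borel" "\<psi> \<in> borel_measurable borel"
    using \<phi> \<psi> by (auto intro: borel_measurable_continuous_onI)
  have cont: "continuous_on UNIV (\<lambda>p::real\<times>real. \<phi> (fst p))" "continuous_on UNIV (\<lambda>p::real\<times>real. \<psi> (snd p))"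
    by (auto intro!: continuous_on_compose2[OF \<phi>] continuous_on_compose2[OF \<psi>] continuous_intros)
  note int = integrable_times_plan(1)[OF k cont(1)] integrable_times_plan(1)[OF k cont(2)]
  have 1: "(\<integral>p. \<phi> (fst p) * k p \<partial>(M\<^sub>0 \<Otimes>\<^sub>M M\<^sub>1)) = (\<integral>x. \<phi> x \<partial>M\<^sub>0)"
  proof -
    have "(\<integral>p. \<phi> (fst p) * k p \<partial>(M\<^sub>0 \<Otimes>\<^sub>M M\<^sub>1)) = (\<integral>x. \<phi> x * (\<integral>y. k (x, y) \<partial>M\<^sub>1) \<partial>M\<^sub>0)"
      by (subst P.integral_fst'[OF int(1), symmetric]) simp
    also have "\<dots> = (\<integral>x. \<phi> x \<partial>M\<^sub>0)"
    proof (rule integral_cong_AE)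
      show "AE x in M\<^sub>0. \<phi> x * (\<integral>y. k (x, y) \<partial>M\<^sub>1) = \<phi> x"
        using k unfolding plan_density_def by (auto elim!: eventually_mono)
    qed measurable
    finally show ?thesis .
  qed
  have 2: "(\<integral>p. \<psi> (snd p) * k p \<partial>(M\<^sub>0 \<Otimes>\<^sub>M M\<^sub>1)) = (\<integral>y. \<psi> y \<partial>M\<^sub>1)"
  proof -
    have "(\<integral>p. \<psi> (snd p) * k p \<partial>(M\<^sub>0 \<Otimes>\<^sub>M M\<^sub>1)) = (\<integral>y. \<psi> y * (\<integral>x. k (x, y) \<partial>M\<^sub>0) \<partial>M\<^sub>1)"
      using P.integral_snd[of "\<lambda>x y. \<psi> y * k (x, y)"] int(2)
      by (simp add: case_prod_beta')
    also have "\<dots> = (\<integral>y. \<psi> y \<partial>M\<^sub>1)"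
    proof (rule integral_cong_AE)
      show "AE y in M\<^sub>1. \<psi> y * (\<integral>x. k (x, y) \<partial>M\<^sub>0) = \<psi> y"
        using k unfolding plan_density_def by (auto elim!: eventually_mono)
    qed measurable
    finally show ?thesis .
  qed
  show ?thesis
    using 1 2 int by (simp add: distrib_right)
qed

text \<open>Both measures are cut into \<open>n\<close> consecutive pieces of mass \<open>1 / n\<close>, and corresponding pieces are
coupled independently.\<close>

definition block_density :: "nat \<Rightarrow> real \<times> real \<Rightarrow> real" where
  "block_density n p = (if \<lfloor>real n * cdf M\<^sub>0 (fst p)\<rfloor> = \<lfloor>real n * cdf M\<^sub>1 (snd p)\<rfloor> then real n else 0)"

lemma block_plan_density:
  assumes "0 < n" shows "plan_density (block_density n)"
  unfolding plan_density_def
proof (intro conjI)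
  have [measurable]: "cdf M\<^sub>0 \<in> borel_measurable borel" "cdf M\<^sub>1 \<in> borel_measurable borel"
    using X.cdf_continuous Y.cdf_continuous by (auto intro: borel_measurable_continuous_onI)
  show "block_density n \<in> borel_measurable (borel \<Otimes>\<^sub>M borel)"
    unfolding block_density_def by measurable
  show "\<forall>p. 0 \<le> block_density n p" by (simp add: block_density_def)
  show "\<exists>B. \<forall>x\<in>{a\<^sub>0..b\<^sub>0}. \<forall>y\<in>{a\<^sub>1..b\<^sub>1}. block_density n (x, y) \<le> B"
    by (rule exI[of _ "real n"]) (simp add: block_density_def)
  show "AE x in M\<^sub>0. (\<integral>y. block_density n (x, y) \<partial>M\<^sub>1) = 1"
    using X.AE_cdf_less_1
  proof eventually_elim
    case (elim x)
    then show ?case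
      using Y.block_mass[OF assms, of "cdf M\<^sub>0 x"] X.cdf_in_unit[of x] by (simp add: block_density_def)
  qed
  show "AE y in M\<^sub>1. (\<integral>x. block_density n (x, y) \<partial>M\<^sub>0) = 1"
    using Y.AE_cdf_less_1
  proof eventually_elim
    case (elim y)
    then show ?case
      using X.block_mass[OF assms, of "cdf M\<^sub>1 y"] Y.cdf_in_unit[of y]
      
      by (simp add: block_density_def eq_commute[of "\<lfloor>real n * cdf M\<^sub>1 y\<rfloor>"])
  qed
qed

text \<open>In a common block the two quantiles differ by at most \<open>1 / n\<close>, and distances on the line are at most
\<open>1 / l\<close> times distances of quantiles.\<close>

lemma block_plan_close:
  assumes "0 < n" "block_density n (x, y) \<noteq> 0" "y \<in> {a\<^sub>1..b\<^sub>1}"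
  shows "\<bar>y - T x\<bar> \<le> 1 / (l * real n)"
proof -
  have "\<lfloor>real n * cdf M\<^sub>0 x\<rfloor> = \<lfloor>real n * cdf M\<^sub>1 y\<rfloor>"
    using assms by (auto simp: block_density_def split: if_splits)
  then have "\<bar>real n * (cdf M\<^sub>1 y - cdf M\<^sub>0 x)\<bar> \<le> 1" unfolding right_diff_distrib by linarith
  then have "real n * \<bar>cdf M\<^sub>1 y - cdf M\<^sub>0 x\<bar> \<le> 1" by (simp add: abs_mult)
  moreover have "real n * (l * \<bar>y - T x\<bar>) \<le> real n * \<bar>cdf M\<^sub>1 y - cdf M\<^sub>0 x\<bar>"
    using T_close_cdf[OF assms(3)] by (intro mult_left_mono) auto
  ultimately have "\<bar>y - T x\<bar> * (l * real n) \<le> 1" by (simp add: mult_ac)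
  then show ?thesis using assms X.l_pos by (subst pos_le_divide_eq) auto
qed

end

section \<open>Sections of the optimal support\<close>

text \<open>The factors of \<open>upper_const\<close> come from the concentration of concave functions, the growth of the
potential, and the value of the block plan.  The two terms of \<open>lower_const\<close> belong to the cases in
which some height, respectively no height, lies in all sections.\<close>

definition upper_const :: "real \<Rightarrow> real \<Rightarrow> real" where
  "upper_const l L = 2 / (3 / 128 * (l / L))\<^sup>2 * (2 * L / l) * (L / (2 * l) * (1 / l)\<^sup>2 + 1)"

definition lower_const :: "real \<Rightarrow> real \<Rightarrow> real" where
  "lower_const l L = min (l / (4 * L\<^sup>2) / 2) (1 / max 1 (8 * L\<^sup>2 / l))"

text \<open>The potentials are continuous on the whole line here, which a constant extension beyond the end
points achieves, so that integrands are continuous and hence measurable everywhere.\<close>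

locale qot_system = two_densities M\<^sub>0 a\<^sub>0 b\<^sub>0 u\<^sub>0 M\<^sub>1 a\<^sub>1 b\<^sub>1 u\<^sub>1 l L
  for M\<^sub>0 a\<^sub>0 b\<^sub>0 u\<^sub>0 M\<^sub>1 a\<^sub>1 b\<^sub>1 u\<^sub>1 l L +
  fixes f g :: "real \<Rightarrow> real" and \<epsilon> :: real
  assumes cont_f: "continuous_on UNIV f" and cont_g: "continuous_on UNIV g" and \<epsilon>_pos: "0 < \<epsilon>"
    and marginal\<^sub>0: "\<And>x. x \<in> {a\<^sub>0..b\<^sub>0} \<Longrightarrow> (\<integral>y. max (slack f g x y) 0 \<partial>M\<^sub>1) = \<epsilon>"
    and marginal\<^sub>1: "\<And>y. y \<in> {a\<^sub>1..b\<^sub>1} \<Longrightarrow> (\<integral>x. max (slack f g x y) 0 \<partial>M\<^sub>0) = \<epsilon>"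
begin

lemma slack_swap: "slack g f y x = slack f g x y"
  by (simp add: slack_def mult.commute)

sublocale H: marginal_equation M\<^sub>1 a\<^sub>1 b\<^sub>1 l L u\<^sub>1 a\<^sub>0 b\<^sub>0 f g \<epsilon>
  using cont_f cont_g \<epsilon>_pos marginal\<^sub>0 by unfold_locales

sublocale V: marginal_equation M\<^sub>0 a\<^sub>0 b\<^sub>0 l L u\<^sub>0 a\<^sub>1 b\<^sub>1 g f \<epsilon>
  using cont_f cont_g \<epsilon>_pos marginal\<^sub>1 by unfold_locales (auto simp: slack_swap)

abbreviation S :: "real \<Rightarrow> real set" where "S \<equiv> support_section {a\<^sub>1..b\<^sub>1} f g"

text \<open>The distance is cut off outside the interval so as to be a Borel function on the whole line.\<close>

definition sec_dist :: "real \<Rightarrow> real" where "sec_dist x = indicator {a\<^sub>0..b\<^sub>0} x * dist_to_singleton (S x) (T x)"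

definition supp :: "(real \<times> real) set" where
  "supp = {p. fst p \<in> {a\<^sub>0..b\<^sub>0} \<and> snd p \<in> {a\<^sub>1..b\<^sub>1} \<and> 0 \<le> slack f g (fst p) (snd p)}"

lemma slack_continuous_prod: "continuous_on UNIV (\<lambda>p. slack f g (fst p) (snd p))"
  by (intro H.slack_continuous continuous_intros)

lemma supp_compact: "compact supp"
proof -
  have "supp = ({a\<^sub>0..b\<^sub>0} \<times> {a\<^sub>1..b\<^sub>1}) \<inter> {p. 0 \<le> slack f g (fst p) (snd p)}"
    by (auto simp: supp_def)
  also have "compact \<dots>"
    by (intro compact_Int_closed compact_Times compact_Icc closed_Collect_le
          continuous_on_const slack_continuous_prod)
  finally show ?thesis .
qed

lemma supp_measurable [measurable]: "supp \<in> sets (borel \<Otimes>\<^sub>M borel)"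
  unfolding borel_prod using supp_compact by (simp add: borel_compact)

lemma in_supp_iff: "x \<in> {a\<^sub>0..b\<^sub>0} \<Longrightarrow> (x, y) \<in> supp \<longleftrightarrow> y \<in> S x"
  by (auto simp: supp_def H.S_eq)

lemma S_compact: "compact (S x)"
proof -
  have "S x = {a\<^sub>1..b\<^sub>1} \<inter> S x" unfolding H.S_eq by blast
  then show ?thesis using compact_Int_closed[OF compact_Icc H.S_closed] by metis
qed

lemma distance_attained:
  assumes "x \<in> {a\<^sub>0..b\<^sub>0}"
  obtains z where "z \<in> S x" "\<bar>z - T x\<bar> = sec_dist x" "\<And>y. y \<in> S x \<Longrightarrow> \<bar>y - T x\<bar> \<le> sec_dist x"
proof -
  obtain y where "y \<in> {a\<^sub>1..b\<^sub>1}" "0 < slack f g x y" using H.exists_slack_pos[OF assms] .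
  then have "S x \<noteq> {}" by (auto simp: H.S_eq)
  then have "\<exists>z\<in>S x. \<forall>y\<in>S x. \<bar>y - T x\<bar> \<le> \<bar>z - T x\<bar>"
    by (intro continuous_attains_sup[OF S_compact] continuous_intros)
  then obtain z where z: "z \<in> S x" "\<And>y. y \<in> S x \<Longrightarrow> \<bar>y - T x\<bar> \<le> \<bar>z - T x\<bar>" by blast
  have "dist_to_singleton (S x) (T x) = \<bar>z - T x\<bar>"
    unfolding dist_to_singleton_def by (rule cSup_eq_maximum) (use z in auto)
  then have "sec_dist x = \<bar>z - T x\<bar>"
    unfolding sec_dist_def using assms by simp
  with z show ?thesis using that by simp
qed

lemma sec_dist_upper: "x \<in> {a\<^sub>0..b\<^sub>0} \<Longrightarrow> y \<in> S x \<Longrightarrow> \<bar>y - T x\<bar> \<le> sec_dist x"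
  by (rule distance_attained)

lemma sec_dist_nonneg: "0 \<le> sec_dist x"
proof (cases "x \<in> {a\<^sub>0..b\<^sub>0}")
  case True
  then obtain z where "\<bar>z - T x\<bar> = sec_dist x" by (rule distance_attained)
  then show ?thesis using abs_ge_zero[of "z - T x"] by simp
qed (simp add: sec_dist_def)

lemma sec_dist_bounded: "sec_dist x \<le> b\<^sub>1 - a\<^sub>1"
proof (cases "x \<in> {a\<^sub>0..b\<^sub>0}")
  case True
  then obtain z where "z \<in> S x" "\<bar>z - T x\<bar> = sec_dist x" by (rule distance_attained)
  then show ?thesis using T_in[of x] by (auto simp: H.S_eq)
qed (use Y.a_less_b in \<open>simp add: sec_dist_def\<close>)

text \<open>Superlevel sets are projections of compact sets, because the largest distance over a section is
attained.\<close>

lemma sec_dist_measurable [measurable]: "sec_dist \<in> borel_measurable borel"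
proof (rule borel_measurable_iff_ge[THEN iffD2, rule_format])
  fix c :: real
  show "{x \<in> space borel. c \<le> sec_dist x} \<in> sets borel"
  proof (cases "c \<le> 0")
    case True
    then have "{x \<in> space borel. c \<le> sec_dist x} = UNIV" using sec_dist_nonneg order_trans by auto
    then show ?thesis by simp
  next
    case False
    let ?F = "supp \<inter> {p. c \<le> \<bar>snd p - T (fst p)\<bar>}"
    have "{x \<in> space borel. c \<le> sec_dist x} = fst ` ?F"
    proof safe
      fix x assume c: "c \<le> sec_dist x"
      then have x: "x \<in> {a\<^sub>0..b\<^sub>0}" using False by (cases "x \<in> {a\<^sub>0..b\<^sub>0}") (simp_all add: sec_dist_def)
      then obtain z where "z \<in> S x" "\<bar>z - T x\<bar> = sec_dist x" by (rule distance_attained)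
      then show "x \<in> fst ` ?F"
        using x c by (intro image_eqI[of _ _ "(x, z)"]) (auto simp: supp_def H.S_eq)
    next
      fix x y assume "(x, y) \<in> supp" "c \<le> \<bar>snd (x, y) - T (fst (x, y))\<bar>"
      then show "c \<le> sec_dist (fst (x, y))"
        using sec_dist_upper[of x y] by (force simp: supp_def H.S_eq)
    qed simp
    also have "compact ?F"
      by (intro compact_Int_closed supp_compact closed_Collect_le continuous_intros
          continuous_on_compose2[OF T_continuous]) auto
    then have "compact (fst ` ?F)" by (intro compact_continuous_image continuous_intros)
    then have "fst ` ?F \<in> sets borel" by (rule borel_compact)
    finally show ?thesis .
  qed
qed

lemma slack_concave:
  shows "x \<in> {a\<^sub>0..b\<^sub>0} \<Longrightarrow> concave_on {a\<^sub>1..b\<^sub>1} (slack f g x)"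
    and "y \<in> {a\<^sub>1..b\<^sub>1} \<Longrightarrow> concave_on {a\<^sub>0..b\<^sub>0} (\<lambda>x. slack f g x y)"
proof -
  have "convex_on {a\<^sub>1..b\<^sub>1} (\<lambda>y. g y + (- x * y + f x))"
  proof (rule convex_on_add[OF V.f_convex])
    show "convex_on {a\<^sub>1..b\<^sub>1} (\<lambda>y. - x * y + f x)"
      by (rule convex_onI) (auto simp: algebra_simps)
  qed
  moreover have "(\<lambda>y. g y + (- x * y + f x)) = (\<lambda>y. - slack f g x y)"
    by (auto simp: slack_def)
  ultimately show "concave_on {a\<^sub>1..b\<^sub>1} (slack f g x)" by (simp add: concave_on_def)
  have "convex_on {a\<^sub>0..b\<^sub>0} (\<lambda>x. f x + (- y * x + g y))"
  proof (rule convex_on_add[OF H.f_convex])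
    show "convex_on {a\<^sub>0..b\<^sub>0} (\<lambda>x. - y * x + g y)"
      by (rule convex_onI) (auto simp: algebra_simps)
  qed
  moreover have "(\<lambda>x. f x + (- y * x + g y)) = (\<lambda>x. - slack f g x y)"
    by (auto simp: slack_def)
  ultimately show "concave_on {a\<^sub>0..b\<^sub>0} (\<lambda>x. slack f g x y)" by (simp add: concave_on_def)
qed

definition \<rho> :: "real \<times> real \<Rightarrow> real" where "\<rho> p = max (slack f g (fst p) (snd p)) 0 / \<epsilon>"

lemma \<rho>_plan: "plan_density \<rho>"
  unfolding plan_density_def
proof (intro conjI)
  have cont: "continuous_on UNIV \<rho>"
    unfolding \<rho>_def using \<epsilon>_pos by (intro continuous_intros slack_continuous_prod) auto
  then show "\<rho> \<in> borel_measurable (borel \<Otimes>\<^sub>M borel)"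
    unfolding borel_prod by (rule borel_measurable_continuous_onI)
  show "\<forall>p. 0 \<le> \<rho> p" using \<epsilon>_pos by (simp add: \<rho>_def)
  have "compact (\<rho> ` ({a\<^sub>0..b\<^sub>0} \<times> {a\<^sub>1..b\<^sub>1}))"
    using cont by (intro compact_continuous_image compact_Times) (auto intro: continuous_on_subset)
  then show "\<exists>B. \<forall>x\<in>{a\<^sub>0..b\<^sub>0}. \<forall>y\<in>{a\<^sub>1..b\<^sub>1}. \<rho> (x, y) \<le> B"
    using compact_imp_bounded[of "\<rho> ` ({a\<^sub>0..b\<^sub>0} \<times> {a\<^sub>1..b\<^sub>1})"] unfolding bounded_iff by (force simp: abs_le_iff)
  show "AE x in M\<^sub>0. (\<integral>y. \<rho> (x, y) \<partial>M\<^sub>1) = 1"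
    using X.AE_in_interval by eventually_elim (use marginal\<^sub>0 \<epsilon>_pos in \<open>simp add: \<rho>_def\<close>)
  show "AE y in M\<^sub>1. (\<integral>x. \<rho> (x, y) \<partial>M\<^sub>0) = 1"
    using Y.AE_in_interval by eventually_elim (use marginal\<^sub>1 \<epsilon>_pos in \<open>simp add: \<rho>_def\<close>)
qed

abbreviation "P \<equiv> M\<^sub>0 \<Otimes>\<^sub>M M\<^sub>1"

text \<open>Up to functions of one variable, which integrate equally against all plans, \<open>c\<close> is \<open>- slack f g\<close>.
The density \<open>\<rho>\<close> minimises \<open>- h * s + \<epsilon> / 2 * s\<^sup>2\<close> over \<open>s \<ge> 0\<close> pointwise, where \<open>h\<close> is the slack; so
the comparison holds under the integral sign.\<close>

lemma \<rho>_optimal: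
  assumes \<sigma>: "plan_density \<sigma>" and F: "continuous_on UNIV F" and G: "continuous_on UNIV G"
  defines "c \<equiv> \<lambda>p. F (fst p) + G (snd p) - fst p * snd p"
  shows "(\<integral>p. c p * \<rho> p \<partial>P) + \<epsilon> / 2 * (\<integral>p. (\<rho> p)\<^sup>2 \<partial>P)
    \<le> (\<integral>p. c p * \<sigma> p \<partial>P) + \<epsilon> / 2 * (\<integral>p. (\<sigma> p)\<^sup>2 \<partial>P)"
proof -
  define w where "w p = (f (fst p) - F (fst p)) + (g (snd p) - G (snd p))" for p :: "real \<times> real"
  have cc: "continuous_on UNIV c" and cw: "continuous_on UNIV w"
    unfolding c_def w_def
    by (intro continuous_intros continuous_on_compose2[OF F] continuous_on_compose2[OF G]
        continuous_on_compose2[OF cont_f] continuous_on_compose2[OF cont_g] subset_UNIV)+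
  have w_int: "(\<integral>p. w p * k p \<partial>P) = (\<integral>x. f x - F x \<partial>M\<^sub>0) + (\<integral>y. g y - G y \<partial>M\<^sub>1)"
    if "plan_density k" for k
    unfolding w_def using that by (intro plan_marginals continuous_intros cont_f cont_g F G)
  have pw: "c p * \<rho> p + \<epsilon> / 2 * (\<rho> p)\<^sup>2 + w p * \<rho> p \<le> c p * \<sigma> p + \<epsilon> / 2 * (\<sigma> p)\<^sup>2 + w p * \<sigma> p" for p
  proof -
    define h where "h = slack f g (fst p) (snd p)"
    have s0: "0 \<le> \<sigma> p" using \<sigma> unfolding plan_density_def by blast
    have cwh: "c p + w p = - h" by (simp add: c_def w_def h_def slack_def)
    have "- h * \<rho> p + \<epsilon> / 2 * (\<rho> p)\<^sup>2 \<le> - h * \<sigma> p + \<epsilon> / 2 * (\<sigma> p)\<^sup>2"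
    proof (cases "0 \<le> h")
      case True
      then have h: "h = \<epsilon> * \<rho> p" using \<epsilon>_pos by (simp add: \<rho>_def h_def)
      have "0 \<le> \<epsilon> / 2 * (\<sigma> p - \<rho> p)\<^sup>2" using \<epsilon>_pos by simp
      then show ?thesis unfolding h by (simp add: power2_eq_square algebra_simps)
    next
      case False
      then have "\<rho> p = 0" by (simp add: \<rho>_def h_def)
      moreover have "0 \<le> - h * \<sigma> p" "0 \<le> \<epsilon> / 2 * (\<sigma> p)\<^sup>2"
        using False s0 \<epsilon>_pos by (auto intro: mult_nonpos_nonneg)
      ultimately show ?thesis by simp
    qed
    moreover have "c p * \<rho> p + w p * \<rho> p = - h * \<rho> p" "c p * \<sigma> p + w p * \<sigma> p = - h * \<sigma> p"
      using cwh by (simp_all flip: distrib_right)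
    ultimately show ?thesis by linarith
  qed
  note ints = integrable_times_plan[OF \<rho>_plan cc] integrable_times_plan(1)[OF \<rho>_plan cw]
    integrable_times_plan[OF \<sigma> cc] integrable_times_plan(1)[OF \<sigma> cw]
  have "(\<integral>p. c p * \<rho> p + \<epsilon> / 2 * (\<rho> p)\<^sup>2 + w p * \<rho> p \<partial>P) \<le> (\<integral>p. c p * \<sigma> p + \<epsilon> / 2 * (\<sigma> p)\<^sup>2 + w p * \<sigma> p \<partial>P)"
    by (intro integral_mono pw Bochner_Integration.integrable_add integrable_mult_right ints)
  moreover have "(\<integral>p. c p * k p + \<epsilon> / 2 * (k p)\<^sup>2 + w p * k p \<partial>P)
      = (\<integral>p. c p * k p \<partial>P) + \<epsilon> / 2 * (\<integral>p. (k p)\<^sup>2 \<partial>P) + (\<integral>p. w p * k p \<partial>P)"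
    if "integrable P (\<lambda>p. c p * k p)" "integrable P (\<lambda>p. (k p)\<^sup>2)" "integrable P (\<lambda>p. w p * k p)" for k
    using that by simp
  ultimately show ?thesis
    using ints by (simp add: w_int[OF \<sigma>] w_int[OF \<rho>_plan])
qed

section \<open>The upper bound: comparison with a block plan\<close>

text \<open>The average is taken against \<open>M\<^sub>0\<close> instead of Lebesgue measure so that the marginal conditions and
Fubini apply directly.\<close>

definition mean_sq_dist :: real where "mean_sq_dist = (\<integral>x. (sec_dist x)\<^sup>2 \<partial>M\<^sub>0)"

lemma integrable_sec_dist: "integrable M\<^sub>0 sec_dist" "integrable M\<^sub>0 (\<lambda>x. (sec_dist x)\<^sup>2)"
proof -
  show "integrable M\<^sub>0 sec_dist"
    using sec_dist_nonneg sec_dist_bounded by (intro X.integrable_bounded[where B = "b\<^sub>1 - a\<^sub>1"]) auto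
  show "integrable M\<^sub>0 (\<lambda>x. (sec_dist x)\<^sup>2)"
    using sec_dist_nonneg sec_dist_bounded
    by (intro X.integrable_bounded[where B = "(b\<^sub>1 - a\<^sub>1)\<^sup>2"]) (auto intro!: power_mono)
qed

lemma mean_sq_dist_nonneg: "0 \<le> mean_sq_dist"
  unfolding mean_sq_dist_def by (rule integral_nonneg_AE) auto

lemma mean_sq_dist_le_second_moment:
  fixes \<kappa> defines "\<kappa> \<equiv> 3 / 128 * (l / L)"
  shows "\<kappa>\<^sup>2 / 2 * mean_sq_dist \<le> (\<integral>p. (snd p - T (fst p))\<^sup>2 * \<rho> p \<partial>P)"
proof -
  have cont: "continuous_on UNIV (\<lambda>p. (snd p - T (fst p))\<^sup>2)"
    by (intro continuous_intros continuous_on_compose2[OF T_continuous]) auto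
  note int = integrable_times_plan(1)[OF \<rho>_plan cont]
  have "(\<integral>x. \<kappa>\<^sup>2 / 2 * (sec_dist x)\<^sup>2 \<partial>M\<^sub>0) \<le> (\<integral>x. (\<integral>y. (y - T x)\<^sup>2 * \<rho> (x, y) \<partial>M\<^sub>1) \<partial>M\<^sub>0)"
  proof (intro X.integral_mono_interval integrable_mult_right integrable_sec_dist)
    show "integrable M\<^sub>0 (\<lambda>x. \<integral>y. (y - T x)\<^sup>2 * \<rho> (x, y) \<partial>M\<^sub>1)"
      using P.integrable_fst'[OF int] by simp
    fix x assume x: "x \<in> {a\<^sub>0..b\<^sub>0}"
    obtain z where z: "z \<in> S x" "\<bar>z - T x\<bar> = sec_dist x" "\<And>y. y \<in> S x \<Longrightarrow> \<bar>y - T x\<bar> \<le> sec_dist x"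
      using distance_attained[OF x] by blast
    have "\<kappa>\<^sup>2 / 2 * (sec_dist x)\<^sup>2 * (\<integral>y. max (slack f g x y) 0 \<partial>M\<^sub>1)
        \<le> (\<integral>y. (y - T x)\<^sup>2 * max (slack f g x y) 0 \<partial>M\<^sub>1)"
      unfolding \<kappa>_def
    proof (rule Y.concave_second_moment)
      show "continuous_on UNIV (slack f g x)"
        by (intro H.slack_continuous continuous_intros)
    qed (use slack_concave(1)[OF x] z in \<open>auto simp: H.S_eq\<close>)
    also have "\<dots> = \<epsilon> * (\<integral>y. (y - T x)\<^sup>2 * \<rho> (x, y) \<partial>M\<^sub>1)"
      using \<epsilon>_pos by (subst integral_mult_right_zero[symmetric]) (simp add: \<rho>_def)
    finally show "\<kappa>\<^sup>2 / 2 * (sec_dist x)\<^sup>2 \<le> (\<integral>y. (y - T x)\<^sup>2 * \<rho> (x, y) \<partial>M\<^sub>1)"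
      using \<epsilon>_pos by (simp add: marginal\<^sub>0[OF x] mult.commute[of _ \<epsilon>])
  qed
  also have "\<dots> = (\<integral>p. (snd p - T (fst p))\<^sup>2 * \<rho> p \<partial>P)"
    using P.integral_fst'[OF int] by simp
  finally show ?thesis by (simp add: mean_sq_dist_def)
qed

text \<open>Chain of comparisons: second moment of \<open>\<rho>\<close>, transport cost of \<open>\<rho>\<close> (lower quadratic bound on the
duality gap), cost plus penalty of the block plan (optimality of \<open>\<rho>\<close>), its explicit value (upper
quadratic bound on the gap).  The penalty of the block plan is \<open>\<epsilon> / 2 * n\<close> because its density takes
only the values \<open>0\<close> and \<open>n\<close>.\<close>

lemma second_moment_le:
  assumes n: "0 < (n::nat)"
  shows "l / (2 * L) * (\<integral>p. (snd p - T (fst p))\<^sup>2 * \<rho> p \<partial>P)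
    \<le> L / (2 * l) * (1 / (l * real n))\<^sup>2 + \<epsilon> / 2 * real n"
proof -
  obtain G where G: "continuous_on UNIV G"
    "\<And>x y. x \<in> {a\<^sub>0..b\<^sub>0} \<Longrightarrow> y \<in> {a\<^sub>1..b\<^sub>1} \<Longrightarrow>
      l / (2 * L) * (y - T x)\<^sup>2 \<le> G y - G (T x) - x * (y - T x) \<and>
      G y - G (T x) - x * (y - T x) \<le> L / (2 * l) * (y - T x)\<^sup>2"
    using convex_potential_exists by blast
  define F where "F x = x * T x - G (T x)" for x
  have F: "continuous_on UNIV F"
    unfolding F_def by (intro continuous_intros T_continuous continuous_on_compose2[OF G(1) T_continuous]) auto
  define c where "c p = F (fst p) + G (snd p) - fst p * snd p" for p
  have c: "l / (2 * L) * (y - T x)\<^sup>2 \<le> c (x, y)" "c (x, y) \<le> L / (2 * l) * (y - T x)\<^sup>2"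
    if "x \<in> {a\<^sub>0..b\<^sub>0}" "y \<in> {a\<^sub>1..b\<^sub>1}" for x y
    using G(2)[OF that] by (auto simp: c_def F_def algebra_simps)
  let ?\<sigma> = "block_density n"
  have \<sigma>: "plan_density ?\<sigma>" using n by (rule block_plan_density)
  have cont: "continuous_on UNIV (\<lambda>p. (snd p - T (fst p))\<^sup>2)"
    by (intro continuous_intros continuous_on_compose2[OF T_continuous]) auto
  have cc: "continuous_on UNIV c"
    unfolding c_def
    by (intro continuous_intros continuous_on_compose2[OF F] continuous_on_compose2[OF G(1)] subset_UNIV)
  note ints = integrable_times_plan[OF \<rho>_plan cc] integrable_times_plan[OF \<sigma> cc]
    integrable_times_plan(1)[OF \<rho>_plan cont]
  have pos: "0 \<le> \<rho> p" "0 \<le> ?\<sigma> p" for p using \<epsilon>_pos by (auto simp: \<rho>_def block_density_def)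
  have mass: "(\<integral>p. ?\<sigma> p \<partial>P) = 1" "integrable P ?\<sigma>"
    using plan_marginals[OF \<sigma>, of "\<lambda>_. 1" "\<lambda>_. 0"] integrable_times_plan(1)[OF \<sigma>, of "\<lambda>_. 1"]
      X.prob_space by auto
  have "l / (2 * L) * (\<integral>p. (snd p - T (fst p))\<^sup>2 * \<rho> p \<partial>P)
      = (\<integral>p. l / (2 * L) * ((snd p - T (fst p))\<^sup>2 * \<rho> p) \<partial>P)" by simp
  also have "\<dots> \<le> (\<integral>p. c p * \<rho> p \<partial>P)"
  proof (intro integral_mono_AE integrable_mult_right ints)
    show "AE p in P. l / (2 * L) * ((snd p - T (fst p))\<^sup>2 * \<rho> p) \<le> c p * \<rho> p"
      using AE_in_rectangle
    proof eventually_elim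
      case (elim p)
      then have "l / (2 * L) * (snd p - T (fst p))\<^sup>2 * \<rho> p \<le> c p * \<rho> p"
        using c(1)[of "fst p" "snd p"] pos(1) by (intro mult_right_mono) auto
      then show ?case by (simp only: mult.assoc)
    qed
  qed
  also have "\<dots> \<le> (\<integral>p. c p * \<rho> p \<partial>P) + \<epsilon> / 2 * (\<integral>p. (\<rho> p)\<^sup>2 \<partial>P)"
    using \<epsilon>_pos by simp
  also have "\<dots> \<le> (\<integral>p. c p * ?\<sigma> p \<partial>P) + \<epsilon> / 2 * (\<integral>p. (?\<sigma> p)\<^sup>2 \<partial>P)"
    unfolding c_def by (rule \<rho>_optimal[OF \<sigma> F G(1)])
  also have "(\<integral>p. (?\<sigma> p)\<^sup>2 \<partial>P) = (\<integral>p. real n * ?\<sigma> p \<partial>P)"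
    by (intro Bochner_Integration.integral_cong) (auto simp: block_density_def power2_eq_square)
  also have "\<dots> = real n" using mass by simp
  also have "(\<integral>p. c p * ?\<sigma> p \<partial>P) \<le> (\<integral>p. L / (2 * l) * (1 / (l * real n))\<^sup>2 * ?\<sigma> p \<partial>P)"
  proof (intro integral_mono_AE integrable_mult_right ints mass)
    show "AE p in P. c p * ?\<sigma> p \<le> L / (2 * l) * (1 / (l * real n))\<^sup>2 * ?\<sigma> p"
      using AE_in_rectangle
    proof eventually_elim
      case (elim p)
      show ?case
      proof (cases "?\<sigma> p = 0")
        case False
        have "\<bar>snd p - T (fst p)\<bar> \<le> 1 / (l * real n)"
          using False elim n block_plan_close[of n "fst p" "snd p"] by simp
        then have "\<bar>snd p - T (fst p)\<bar>\<^sup>2 \<le> (1 / (l * real n))\<^sup>2" by (intro power_mono) auto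
        then have "L / (2 * l) * (snd p - T (fst p))\<^sup>2 \<le> L / (2 * l) * (1 / (l * real n))\<^sup>2"
          using X.L_pos X.l_pos by (intro mult_left_mono) auto
        then have "c p \<le> L / (2 * l) * (1 / (l * real n))\<^sup>2"
          using c(2)[of "fst p" "snd p"] elim by simp
        then show ?thesis using pos(2) by (intro mult_right_mono) auto
      qed simp
    qed
  qed
  also have "\<dots> = L / (2 * l) * (1 / (l * real n))\<^sup>2" using mass by simp
  finally show ?thesis by simp
qed

lemma mean_sq_dist_upper:
  assumes "\<epsilon> < 1"
  shows "mean_sq_dist \<le> upper_const l L * (\<epsilon> powr (1/3))\<^sup>2"
proof -
  define r where "r = \<epsilon> powr (1/3)"
  have r: "0 < r" "r < 1" "r ^ 3 = \<epsilon>"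
    using \<epsilon>_pos assms powr_less_mono2[of "1/3" \<epsilon> 1]
    by (auto simp: r_def powr_realpow[symmetric] powr_powr)
  \<comment> \<open>This choice balances the excess cost \<open>1 / n\<^sup>2\<close> against the penalty \<open>\<epsilon> * n = r ^ 3 * n\<close>.\<close>
  define n where "n = nat \<lceil>1 / r\<rceil>"
  have n: "1 / r \<le> real n" "real n \<le> 1 / r + 1" using r by (auto simp: n_def)
  have n0: "0 < n" using n r by (cases "n = 0") (auto simp: divide_le_0_iff)
  have nr: "1 / real n \<le> r" "real n \<le> 2 / r"
    using n n0 r by (auto simp: field_simps)
  have "(1 / (l * real n))\<^sup>2 = (1 / l)\<^sup>2 * (1 / real n)\<^sup>2" by (simp add: power_divide power_mult_distrib)
  also have "\<dots> \<le> (1 / l)\<^sup>2 * r\<^sup>2" using nr n0 by (intro mult_left_mono power_mono) auto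
  finally have 1: "L / (2 * l) * (1 / (l * real n))\<^sup>2 \<le> L / (2 * l) * ((1 / l)\<^sup>2 * r\<^sup>2)"
    using X.L_pos X.l_pos by (intro mult_left_mono) auto
  have "\<epsilon> / 2 * real n \<le> r ^ 3 / 2 * (2 / r)"
    using nr r \<epsilon>_pos by (simp only: r(3)) (intro mult_left_mono; simp)
  also have "\<dots> = r\<^sup>2" using r(1) by (simp add: power3_eq_cube power2_eq_square)
  finally have 2: "\<epsilon> / 2 * real n \<le> r\<^sup>2" .
  define m where "m = (\<integral>p. (snd p - T (fst p))\<^sup>2 * \<rho> p \<partial>P)"
  define A where "A = L / (2 * l) * (1 / l)\<^sup>2 + 1"
  have "l / (2 * L) * m \<le> A * r\<^sup>2"
    using second_moment_le[OF n0] 1 2 by (simp add: m_def A_def algebra_simps)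
  then have "2 * L / l * (l / (2 * L) * m) \<le> 2 * L / l * (A * r\<^sup>2)"
    using X.L_pos X.l_pos by (intro mult_left_mono) auto
  then have m: "m \<le> 2 * L / l * (A * r\<^sup>2)" using X.L_pos X.l_pos by simp
  define K where "K = (3 / 128 * (l / L))\<^sup>2"
  have K: "0 < K" using X.L_pos X.l_pos by (simp add: K_def)
  have "K / 2 * mean_sq_dist \<le> m" using mean_sq_dist_le_second_moment by (simp add: K_def m_def)
  then have "K / 2 * mean_sq_dist \<le> 2 * L / l * (A * r\<^sup>2)" using m by simp
  then have "2 / K * (K / 2 * mean_sq_dist) \<le> 2 / K * (2 * L / l * (A * r\<^sup>2))"
    using K by (intro mult_left_mono) auto
  then have "mean_sq_dist \<le> 2 / K * (2 * L / l * (A * r\<^sup>2))" using K by simp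
  then show ?thesis by (simp add: upper_const_def K_def A_def r_def mult.assoc)
qed

section \<open>The lower bound: variation of the slack along the support\<close>

lemma measure_S_le:
  assumes "x \<in> {a\<^sub>0..b\<^sub>0}"
  shows "measure M\<^sub>1 (S x) \<le> 2 * L * sec_dist x"
proof -
  have "measure M\<^sub>1 (S x) \<le> L * ((T x + sec_dist x) - (T x - sec_dist x))"
  proof (rule Y.measure_le_length)
    show "S x \<inter> {a\<^sub>1..b\<^sub>1} \<subseteq> {T x - sec_dist x..T x + sec_dist x}"
    proof
      fix y assume "y \<in> S x \<inter> {a\<^sub>1..b\<^sub>1}"
      then have "\<bar>y - T x\<bar> \<le> sec_dist x" using sec_dist_upper[OF assms] by auto
      then show "y \<in> {T x - sec_dist x..T x + sec_dist x}" by auto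
    qed
  qed (use sec_dist_nonneg[of x] in auto)
  then show ?thesis by (simp add: algebra_simps)
qed

lemma barycenter_close: "x \<in> {a\<^sub>0..b\<^sub>0} \<Longrightarrow> \<bar>H.barycenter x - T x\<bar> \<le> sec_dist x"
  by (rule H.barycenter_near) (auto intro: sec_dist_upper)

text \<open>The height \<open>y\<close> lies in every section, so the distance is at least \<open>\<bar>y - T x\<bar>\<close>.  Since \<open>T\<close> is expansive,
\<open>T x\<close> is within \<open>\<eta>\<close> of \<open>y\<close> only on an interval around \<open>R y\<close> of length \<open>2 * L / l * \<eta>\<close>; for the chosen
\<open>\<eta>\<close> it has mass at most one half.\<close>

lemma mean_sq_dist_lower_full_section:
  assumes y: "y \<in> {a\<^sub>1..b\<^sub>1}" and full: "\<And>x. x \<in> {a\<^sub>0..b\<^sub>0} \<Longrightarrow> 0 \<le> slack f g x y"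
  shows "(l / (4 * L\<^sup>2))\<^sup>2 / 2 \<le> mean_sq_dist"
proof -
  define \<eta> where "\<eta> = l / (4 * L\<^sup>2)"
  have \<eta>: "0 < \<eta>" using X.l_pos X.L_pos by (simp add: \<eta>_def)
  let ?A = "{x. \<bar>T x - y\<bar> < \<eta>}"
  have [measurable]: "?A \<in> sets borel" by measurable
  have "measure M\<^sub>0 ?A \<le> L * ((R y + L / l * \<eta>) - (R y - L / l * \<eta>))"
  proof (rule X.measure_le_length)
    show "?A \<inter> {a\<^sub>0..b\<^sub>0} \<subseteq> {R y - L / l * \<eta>..R y + L / l * \<eta>}"
    proof
      fix x assume "x \<in> ?A \<inter> {a\<^sub>0..b\<^sub>0}"
      then have "l * \<bar>x - R y\<bar> \<le> L * \<bar>T x - y\<bar>" "L * \<bar>T x - y\<bar> \<le> L * \<eta>"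
        using T_expansive[OF R_in, of x y] T_R[OF y] X.L_pos by auto
      then have "\<bar>x - R y\<bar> \<le> L / l * \<eta>" using X.l_pos by (simp add: field_simps)
      then show "x \<in> {R y - L / l * \<eta>..R y + L / l * \<eta>}" by auto
    qed
  qed (use \<eta> X.l_pos X.L_pos in auto)
  also have "\<dots> = 1 / 2" using X.l_pos X.L_pos by (simp add: \<eta>_def power2_eq_square)
  finally have A: "measure M\<^sub>0 ?A \<le> 1 / 2" .
  have "(\<integral>x. \<eta>\<^sup>2 * (1 - indicator ?A x) \<partial>M\<^sub>0) \<le> mean_sq_dist"
    unfolding mean_sq_dist_def
  proof (intro X.integral_mono_interval integrable_sec_dist)
    show "integrable M\<^sub>0 (\<lambda>x. \<eta>\<^sup>2 * (1 - indicator ?A x))"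
      by (intro integrable_mult_right Bochner_Integration.integrable_diff) auto
    fix x assume x: "x \<in> {a\<^sub>0..b\<^sub>0}"
    have "y \<in> S x" using full[OF x] y by (simp add: H.S_eq)
    then have "\<bar>y - T x\<bar> \<le> sec_dist x" by (rule sec_dist_upper[OF x])
    then have "\<eta>\<^sup>2 \<le> (sec_dist x)\<^sup>2" if "x \<notin> ?A" using that \<eta> by (intro power_mono) auto
    then show "\<eta>\<^sup>2 * (1 - indicator ?A x) \<le> (sec_dist x)\<^sup>2" by (cases "x \<in> ?A") auto
  qed
  also have "(\<integral>x. \<eta>\<^sup>2 * (1 - indicator ?A x) \<partial>M\<^sub>0) = \<eta>\<^sup>2 * (1 - measure M\<^sub>0 ?A)"
    using X.prob_space by simp
  finally have "\<eta>\<^sup>2 * (1 - measure M\<^sub>0 ?A) \<le> mean_sq_dist" .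
  moreover have "\<eta>\<^sup>2 * (1 / 2) \<le> \<eta>\<^sup>2 * (1 - measure M\<^sub>0 ?A)" using A by (intro mult_left_mono) auto
  ultimately show ?thesis by (simp add: \<eta>_def)
qed

text \<open>On the support both \<open>y\<close> and the barycenter of \<open>S x\<close> are within \<open>sec_dist x\<close> of \<open>T x\<close>, which bounds the
partial derivative \<open>y - f' x\<close> of the slack.\<close>

definition slope_bound :: "real \<Rightarrow> real \<Rightarrow> real" where "slope_bound y x = 2 * sec_dist x * indicator supp (x, y)"

lemma slope_bound_measurable [measurable]: "(\<lambda>p. slope_bound (snd p) (fst p)) \<in> borel_measurable (borel \<Otimes>\<^sub>M borel)" "slope_bound y \<in> borel_measurable borel"
  unfolding slope_bound_def by measurable

lemma slope_bound_bounds: "0 \<le> slope_bound y x" "slope_bound y x \<le> 2 * (b\<^sub>1 - a\<^sub>1)"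
  using sec_dist_nonneg[of x] sec_dist_bounded[of x] by (auto simp: slope_bound_def indicator_def)

lemma slope_bound_integrable: "{s..t} \<subseteq> {a\<^sub>0..b\<^sub>0} \<Longrightarrow> slope_bound y integrable_on {s..t}"
  and slope_bound_integral_le: "integral {a\<^sub>0..b\<^sub>0} (slope_bound y) \<le> (1 / l) * (\<integral>x. slope_bound y x \<partial>M\<^sub>0)"
proof -
  note cmp = X.lebesgue_integral_comparison[OF slope_bound_measurable(2)[of y], of "2 * (b\<^sub>1 - a\<^sub>1)"]
  have int: "set_integrable lborel {a\<^sub>0..b\<^sub>0} (slope_bound y)" by (rule cmp(1)) (use slope_bound_bounds in auto)
  show "slope_bound y integrable_on {s..t}" if "{s..t} \<subseteq> {a\<^sub>0..b\<^sub>0}"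
    using set_borel_integral_eq_integral(1)[OF int] that by (rule integrable_on_subinterval)
  have "l * integral {a\<^sub>0..b\<^sub>0} (slope_bound y) \<le> (\<integral>x. slope_bound y x \<partial>M\<^sub>0)"
    using cmp(2) slope_bound_bounds set_borel_integral_eq_integral(2)[OF int] by simp
  then show "integral {a\<^sub>0..b\<^sub>0} (slope_bound y) \<le> (1 / l) * (\<integral>x. slope_bound y x \<partial>M\<^sub>0)"
    using X.l_pos by (simp add: field_simps)
qed

text \<open>Concavity in \<open>x\<close> keeps the whole segment from \<open>s\<close> to \<open>t\<close> in the support at height \<open>y\<close>, so the slope
bound can be integrated along it.\<close>

lemma slack_variation:
  assumes st: "s \<in> {a\<^sub>0..b\<^sub>0}" "t \<in> {a\<^sub>0..b\<^sub>0}" "s \<le> t" and y: "y \<in> {a\<^sub>1..b\<^sub>1}"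
    and ends: "0 \<le> slack f g s y" "0 \<le> slack f g t y"
  shows "\<bar>slack f g t y - slack f g s y\<bar> \<le> (1 / l) * (\<integral>x. slope_bound y x \<partial>M\<^sub>0)"
proof -
  have sub: "{s..t} \<subseteq> {a\<^sub>0..b\<^sub>0}" using st by auto
  have pos: "0 \<le> slack f g x y" if "x \<in> {s..t}" for x
  proof -
    have "convex {x \<in> {a\<^sub>0..b\<^sub>0}. 0 \<le> slack f g x y}"
      unfolding convex_alt
    proof safe
      fix x x' w :: real
      assume *: "x \<in> {a\<^sub>0..b\<^sub>0}" "0 \<le> slack f g x y" "x' \<in> {a\<^sub>0..b\<^sub>0}" "0 \<le> slack f g x' y" "0 \<le> w" "w \<le> 1"
      show "(1 - w) *\<^sub>R x + w *\<^sub>R x' \<in> {a\<^sub>0..b\<^sub>0}" using * by (intro convexD) auto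
      have "0 \<le> (1 - w) * slack f g x y + w * slack f g x' y" using * by simp
      also have "\<dots> \<le> slack f g ((1 - w) *\<^sub>R x + w *\<^sub>R x') y"
        using * by (intro concave_onD[OF slack_concave(2)[OF y]]) auto
      finally show "0 \<le> slack f g ((1 - w) *\<^sub>R x + w *\<^sub>R x') y" .
    qed
    then have "closed_segment s t \<subseteq> {x \<in> {a\<^sub>0..b\<^sub>0}. 0 \<le> slack f g x y}"
      using st ends by (intro closed_segment_subset) auto
    then show ?thesis using that st by (auto simp: closed_segment_eq_real_ivl)
  qed
  have der: "((\<lambda>x. slack f g x y) has_vector_derivative (y - H.barycenter x)) (at x within {s..t})"
    if "x \<in> {s..t}" for x
  proof -
    have "(f has_real_derivative H.barycenter x) (at x within {s..t})"
      using H.f_has_derivative[OF V.f_convex, of x] sub that by (auto intro: DERIV_subset)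
    then have "((\<lambda>x. slack f g x y) has_real_derivative (y - H.barycenter x)) (at x within {s..t})"
      unfolding slack_def by (auto intro!: derivative_eq_intros)
    then show ?thesis by (simp add: has_real_derivative_iff_has_vector_derivative)
  qed
  have ftc: "((\<lambda>x. y - H.barycenter x) has_integral (slack f g t y - slack f g s y)) {s..t}"
    by (rule fundamental_theorem_of_calculus[OF st(3) der])
  have "\<bar>slack f g t y - slack f g s y\<bar> = norm (integral {s..t} (\<lambda>x. y - H.barycenter x))"
    using ftc by (simp add: integral_unique)
  also have "\<dots> \<le> integral {s..t} (slope_bound y)"
  proof (rule integral_norm_bound_integral)
    show "(\<lambda>x. y - H.barycenter x) integrable_on {s..t}" using ftc by blast
    show "slope_bound y integrable_on {s..t}" by (rule slope_bound_integrable[OF sub])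
    fix x assume x: "x \<in> {s..t}"
    then have xX: "x \<in> {a\<^sub>0..b\<^sub>0}" using sub by blast
    have supp: "(x, y) \<in> supp" using pos[OF x] xX y by (simp add: supp_def)
    then have "\<bar>y - T x\<bar> \<le> sec_dist x" using sec_dist_upper[OF xX] in_supp_iff[OF xX] by blast
    then show "norm (y - H.barycenter x) \<le> slope_bound y x"
      using barycenter_close[OF xX] supp by (simp add: slope_bound_def)
  qed
  also have "\<dots> \<le> integral {a\<^sub>0..b\<^sub>0} (slope_bound y)"
    by (rule integral_subset_le[OF sub slope_bound_integrable[OF sub] slope_bound_integrable]) (auto simp: slope_bound_bounds)
  also have "\<dots> \<le> (1 / l) * (\<integral>x. slope_bound y x \<partial>M\<^sub>0)" by (rule slope_bound_integral_le)
  finally show ?thesis .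
qed

text \<open>Starting from \<open>x'\<close>, where the slack is negative, it vanishes somewhere on the way to \<open>x\<close>; the claim
is the variation from that zero to \<open>x\<close>.\<close>

lemma slack_le:
  assumes y: "y \<in> {a\<^sub>1..b\<^sub>1}" and x': "x' \<in> {a\<^sub>0..b\<^sub>0}" "slack f g x' y < 0" and x: "x \<in> {a\<^sub>0..b\<^sub>0}"
  shows "slack f g x y \<le> (1 / l) * (\<integral>x. slope_bound y x \<partial>M\<^sub>0)"
proof (cases "0 \<le> slack f g x y")
  case False
  have "0 \<le> (1 / l) * (\<integral>x. slope_bound y x \<partial>M\<^sub>0)"
    using X.l_pos slope_bound_bounds by (intro mult_nonneg_nonneg integral_nonneg_AE) auto
  with False show ?thesis by linarith
next
  case True
  have cont: "continuous_on UNIV (\<lambda>x. slack f g x y)" by (intro H.slack_continuous continuous_intros)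
  show ?thesis
  proof (cases "x' \<le> x")
    case le: True
    obtain w where w: "x' \<le> w" "w \<le> x" "slack f g w y = 0"
      using IVT'[of "\<lambda>x. slack f g x y" x' 0 x] x' True le continuous_on_subset[OF cont] by auto
    show ?thesis using slack_variation[of w x y] w x x' y True by auto
  next
    case False
    then obtain w where w: "x \<le> w" "w \<le> x'" "slack f g w y = 0"
      using IVT2'[of "\<lambda>x. slack f g x y" x' 0 x] x' True continuous_on_subset[OF cont] by auto
    show ?thesis using slack_variation[of x w y] w x x' y True by auto
  qed
qed

lemma integral_sec_dist_le: "(\<integral>x. sec_dist x \<partial>M\<^sub>0) \<le> sqrt mean_sq_dist"
proof -
  have "(\<integral>x. sec_dist x \<partial>M\<^sub>0)\<^sup>2 \<le> mean_sq_dist"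
    using X.variance_eq[OF integrable_sec_dist] X.variance_positive[of sec_dist] by (simp add: mean_sq_dist_def)
  then show ?thesis by (rule real_le_rsqrt)
qed

text \<open>With \<open>A y\<close> the bound on the slack at height \<open>y\<close> and \<open>m y\<close> the mass of the support at that height, the
marginal equation gives \<open>\<epsilon> \<le> A y * m y\<close>.  Integrating along vertical lines first bounds the
integrals of \<open>A\<close> and \<open>m\<close> by the second and first moments of the distance, and the Cauchy-Schwarz
inequality combines them.\<close>

lemma mean_sq_dist_lower_partial_sections:
  assumes part: "\<And>y. y \<in> {a\<^sub>1..b\<^sub>1} \<Longrightarrow> \<exists>x\<in>{a\<^sub>0..b\<^sub>0}. slack f g x y < 0"
  shows "\<epsilon> \<le> 8 * L\<^sup>2 / l * sqrt mean_sq_dist ^ 3"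
proof -
  define A where "A y = (1 / l) * (\<integral>x. slope_bound y x \<partial>M\<^sub>0)" for y
  define m :: "real \<Rightarrow> real" where "m y = (\<integral>x. indicator supp (x, y) \<partial>M\<^sub>0)" for y
  have A0: "0 \<le> A y" for y
    unfolding A_def using X.l_pos slope_bound_bounds by (intro mult_nonneg_nonneg integral_nonneg_AE) auto
  have m0: "0 \<le> m y" for y
    unfolding m_def by (intro integral_nonneg_AE) auto
  have \<epsilon>_le: "\<epsilon> \<le> A y * m y" if y: "y \<in> {a\<^sub>1..b\<^sub>1}" for y
  proof -
    obtain x' where x': "x' \<in> {a\<^sub>0..b\<^sub>0}" "slack f g x' y < 0" using part[OF y] by blast
    have "\<epsilon> = (\<integral>x. max (slack f g x y) 0 \<partial>M\<^sub>0)" using marginal\<^sub>1[OF y] by simp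
    also have "\<dots> \<le> (\<integral>x. A y * indicator supp (x, y) \<partial>M\<^sub>0)"
    proof (rule X.integral_mono_interval)
      show "integrable M\<^sub>0 (\<lambda>x. max (slack f g x y) 0)"
        by (intro X.integrable_continuous continuous_intros H.slack_continuous)
      show "integrable M\<^sub>0 (\<lambda>x. A y * indicator supp (x, y))"
        by (intro integrable_mult_right X.integrable_bounded[where B=1]) auto
      show "max (slack f g x y) 0 \<le> A y * indicator supp (x, y)" if x: "x \<in> {a\<^sub>0..b\<^sub>0}" for x
        using slack_le[OF y x' x] x y A0[of y] by (auto simp: A_def supp_def split: split_indicator)
    qed
    also have "\<dots> = A y * m y" by (simp add: m_def)
    finally show ?thesis .
  qed
  have intE: "integrable P (\<lambda>p. indicator supp p :: real)"
    by (rule integrable_prod_bounded[where B=1]) auto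
  have int_slope: "integrable P (\<lambda>p. slope_bound (snd p) (fst p))"
    using slope_bound_bounds by (intro integrable_prod_bounded[where B="2 * (b\<^sub>1 - a\<^sub>1)"]) auto
  have int: "integrable M\<^sub>1 A" "integrable M\<^sub>1 m"
    unfolding A_def m_def
    using P.integrable_snd[of "\<lambda>x y. slope_bound y x"] int_slope P.integrable_snd[of "\<lambda>x y. indicator supp (x, y)"] intE
    by (auto simp: case_prod_beta')
  have secE: "(\<integral>y. indicator supp (x, y) \<partial>M\<^sub>1) \<le> 2 * L * sec_dist x" if "x \<in> {a\<^sub>0..b\<^sub>0}" for x
  proof -
    have "(\<integral>y. indicator supp (x, y) \<partial>M\<^sub>1) = (\<integral>y. indicat_real (S x) y \<partial>M\<^sub>1)"
      using in_supp_iff[OF that] by (intro Bochner_Integration.integral_cong) (auto simp: indicator_def)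
    then show ?thesis using measure_S_le[OF that] by simp
  qed
  have "(\<integral>y. m y \<partial>M\<^sub>1) = (\<integral>x. (\<integral>y. indicator supp (x, y) \<partial>M\<^sub>1) \<partial>M\<^sub>0)"
    unfolding m_def using P.Fubini_integral[of "\<lambda>x y. indicator supp (x, y)"] intE by simp
  also have "\<dots> \<le> (\<integral>x. 2 * L * sec_dist x \<partial>M\<^sub>0)"
    using P.integrable_fst'[OF intE] secE
    by (intro X.integral_mono_interval integrable_mult_right integrable_sec_dist) auto
  also have "\<dots> \<le> 2 * L * sqrt mean_sq_dist"
    using integral_sec_dist_le X.L_pos by simp
  finally have m_int: "(\<integral>y. m y \<partial>M\<^sub>1) \<le> 2 * L * sqrt mean_sq_dist" .
  have "(\<integral>y. A y \<partial>M\<^sub>1) = (1 / l) * (\<integral>x. (\<integral>y. slope_bound y x \<partial>M\<^sub>1) \<partial>M\<^sub>0)"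
    unfolding A_def using P.Fubini_integral[of "\<lambda>x y. slope_bound y x"] int_slope by (simp add: case_prod_beta')
  also have "\<dots> \<le> (1 / l) * (\<integral>x. 4 * L * (sec_dist x)\<^sup>2 \<partial>M\<^sub>0)"
  proof (intro mult_left_mono X.integral_mono_interval integrable_mult_right integrable_sec_dist)
    show "integrable M\<^sub>0 (\<lambda>x. \<integral>y. slope_bound y x \<partial>M\<^sub>1)" using P.integrable_fst'[OF int_slope] by simp
    fix x assume x: "x \<in> {a\<^sub>0..b\<^sub>0}"
    have "(\<integral>y. slope_bound y x \<partial>M\<^sub>1) = 2 * sec_dist x * (\<integral>y. indicator supp (x, y) \<partial>M\<^sub>1)" by (simp add: slope_bound_def)
    also have "\<dots> \<le> 2 * sec_dist x * (2 * L * sec_dist x)" using secE[OF x] sec_dist_nonneg by (intro mult_left_mono) auto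
    finally show "(\<integral>y. slope_bound y x \<partial>M\<^sub>1) \<le> 4 * L * (sec_dist x)\<^sup>2" by (simp add: power2_eq_square mult_ac)
  qed (use X.l_pos in auto)
  finally have A_int: "(\<integral>y. A y \<partial>M\<^sub>1) \<le> 4 * L / l * mean_sq_dist" by (simp add: mean_sq_dist_def)
  \<comment> \<open>Cauchy-Schwarz in the form of the arithmetic-geometric mean inequality with a free weight
    \<open>t\<close>, which is optimised afterwards.\<close>
  have main: "2 * sqrt \<epsilon> \<le> t * (4 * L / l * mean_sq_dist) + 2 * L * sqrt mean_sq_dist / t" if t: "0 < t" for t
  proof -
    have "(\<integral>y. 2 * sqrt \<epsilon> \<partial>M\<^sub>1) \<le> (\<integral>y. t * A y + 1 / t * m y \<partial>M\<^sub>1)"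
    proof (intro Y.integral_mono_interval Bochner_Integration.integrable_add integrable_mult_right int)
      fix y assume y: "y \<in> {a\<^sub>1..b\<^sub>1}"
      have "sqrt \<epsilon> \<le> sqrt ((t * A y) * (1 / t * m y))" using \<epsilon>_le[OF y] t by (simp add: mult_ac)
      also have "\<dots> \<le> (t * A y + 1 / t * m y) / 2"
        using A0 m0 t by (intro arith_geo_mean_sqrt) auto
      finally show "2 * sqrt \<epsilon> \<le> t * A y + 1 / t * m y" by simp
    qed simp
    also have "\<dots> = t * (\<integral>y. A y \<partial>M\<^sub>1) + 1 / t * (\<integral>y. m y \<partial>M\<^sub>1)" using int by simp
    also have "\<dots> \<le> t * (4 * L / l * mean_sq_dist) + 1 / t * (2 * L * sqrt mean_sq_dist)"
      using A_int m_int t by (intro add_mono mult_left_mono) auto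
    finally show ?thesis using Y.prob_space by simp
  qed
  have q0: "0 < mean_sq_dist"
  proof (rule ccontr)
    assume "\<not> 0 < mean_sq_dist"
    then have "mean_sq_dist = 0" using mean_sq_dist_nonneg by simp
    then show False using main[of 1] \<epsilon>_pos by simp
  qed
  define a where "a = 4 * L / l * mean_sq_dist"
  define b where "b = 2 * L * sqrt mean_sq_dist"
  have ab: "0 < a" "0 < b" using q0 X.L_pos X.l_pos by (auto simp: a_def b_def)
  have "0 < sqrt (b / a)" using ab by simp
  then have "2 * sqrt \<epsilon> \<le> sqrt (b / a) * a + b / sqrt (b / a)"
    unfolding a_def b_def by (rule main)
  also have "\<dots> = 2 * sqrt (a * b)"
    using ab by (simp add: real_sqrt_divide real_sqrt_mult field_simps)
  finally have "\<epsilon> \<le> a * b" by simp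
  also have "a * b = 8 * L\<^sup>2 / l * sqrt mean_sq_dist ^ 3"
    using q0 by (simp add: a_def b_def power2_eq_square power3_eq_cube)
  finally show ?thesis .
qed

lemma sqrt_mean_sq_dist_lower:
  assumes "\<epsilon> < 1"
  shows "lower_const l L * \<epsilon> powr (1/3) \<le> sqrt mean_sq_dist"
proof -
  define r where "r = \<epsilon> powr (1/3)"
  have r: "0 < r" "r < 1" "r ^ 3 = \<epsilon>"
    using \<epsilon>_pos assms powr_less_mono2[of "1/3" \<epsilon> 1]
    by (auto simp: r_def powr_realpow[symmetric] powr_powr)
  show ?thesis
  proof (cases "\<exists>y\<in>{a\<^sub>1..b\<^sub>1}. \<forall>x\<in>{a\<^sub>0..b\<^sub>0}. 0 \<le> slack f g x y")
    case True
    define \<eta> where "\<eta> = l / (4 * L\<^sup>2)"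
    have \<eta>: "0 < \<eta>" using X.l_pos X.L_pos by (simp add: \<eta>_def)
    have "\<eta>\<^sup>2 / 2 \<le> mean_sq_dist" using True mean_sq_dist_lower_full_section unfolding \<eta>_def by blast
    moreover have "(\<eta> / 2)\<^sup>2 \<le> \<eta>\<^sup>2 / 2" by (simp add: power_divide)
    ultimately have "(\<eta> / 2)\<^sup>2 \<le> mean_sq_dist" by linarith
    then have "\<eta> / 2 \<le> sqrt mean_sq_dist" by (rule real_le_rsqrt)
    moreover have "lower_const l L * r \<le> \<eta> / 2 * 1"
      using r \<eta> by (intro mult_mono) (auto simp: lower_const_def \<eta>_def)
    ultimately show ?thesis by (simp add: r_def)
  next
    case False
    define K where "K = max 1 (8 * L\<^sup>2 / l)"
    have K: "1 \<le> K" "8 * L\<^sup>2 / l \<le> K" by (auto simp: K_def)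
    have s: "0 \<le> sqrt mean_sq_dist" using mean_sq_dist_nonneg by simp
    have "r ^ 3 \<le> 8 * L\<^sup>2 / l * sqrt mean_sq_dist ^ 3"
      unfolding r(3) by (rule mean_sq_dist_lower_partial_sections) (use False in \<open>auto simp: not_le\<close>)
    also have "\<dots> \<le> K * sqrt mean_sq_dist ^ 3" using K s by (intro mult_right_mono) auto
    also have "\<dots> \<le> K ^ 3 * sqrt mean_sq_dist ^ 3"
      using K s power_increasing[of 1 3 K] by (intro mult_right_mono) auto
    finally have "r ^ 3 \<le> (K * sqrt mean_sq_dist) ^ 3" by (simp add: power_mult_distrib)
    then have "r \<le> K * sqrt mean_sq_dist" using K s r by (subst (asm) power_mono_iff) auto
    then have "1 / K * r \<le> sqrt mean_sq_dist" using K by (simp add: divide_simps mult.commute)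
    moreover have "lower_const l L * r \<le> 1 / K * r"
      using r by (intro mult_right_mono) (auto simp: lower_const_def K_def)
    ultimately show ?thesis by (simp add: r_def)
  qed
qed

lemma sqrt_mean_sq_dist_upper:
  assumes "\<epsilon> < 1"
  shows "sqrt mean_sq_dist \<le> sqrt (upper_const l L) * \<epsilon> powr (1/3)"
proof -
  have "sqrt mean_sq_dist \<le> sqrt (upper_const l L * (\<epsilon> powr (1/3))\<^sup>2)"
    using mean_sq_dist_upper[OF assms] by simp
  then show ?thesis by (simp add: real_sqrt_mult)
qed

text \<open>The barycenter is the derivative of \<open>f\<close>, and its distance from \<open>T x\<close> is at most \<open>sec_dist x\<close>; so the
derivative estimate inherits the constant of the upper bound.\<close>

lemma L2_estimates:
  assumes "\<epsilon> < 1"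
  shows "square_integrable_on {a\<^sub>0..b\<^sub>0} sec_dist"
    and "lower_const l L / sqrt L * \<epsilon> powr (1/3) \<le> L2_norm_on {a\<^sub>0..b\<^sub>0} sec_dist"
    and "L2_norm_on {a\<^sub>0..b\<^sub>0} sec_dist \<le> sqrt (upper_const l L) / sqrt l * \<epsilon> powr (1/3)"
    and "square_integrable_on {a\<^sub>0..b\<^sub>0} (\<lambda>x. H.barycenter x - T x)"
    and "L2_norm_on {a\<^sub>0..b\<^sub>0} (\<lambda>x. H.barycenter x - T x) \<le> sqrt (upper_const l L) / sqrt l * \<epsilon> powr (1/3)"
proof -
  have B: "\<bar>sec_dist x\<bar> \<le> b\<^sub>1 - a\<^sub>1" for x using sec_dist_nonneg[of x] sec_dist_bounded[of x] by simp
  note cmp = X.L2_norm_comparison[OF sec_dist_measurable B]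
  show "square_integrable_on {a\<^sub>0..b\<^sub>0} sec_dist" by (rule cmp(1))
  show "lower_const l L / sqrt L * \<epsilon> powr (1/3) \<le> L2_norm_on {a\<^sub>0..b\<^sub>0} sec_dist"
    using cmp(3) sqrt_mean_sq_dist_lower[OF assms] X.L_pos by (simp add: mean_sq_dist_def field_simps)
  show "L2_norm_on {a\<^sub>0..b\<^sub>0} sec_dist \<le> sqrt (upper_const l L) / sqrt l * \<epsilon> powr (1/3)"
    using cmp(2) sqrt_mean_sq_dist_upper[OF assms] X.l_pos by (simp add: mean_sq_dist_def field_simps)
  define e where "e x = indicator {a\<^sub>0..b\<^sub>0} x *\<^sub>R (H.barycenter x - T x)" for x
  have e_sec_dist: "\<bar>e x\<bar> \<le> sec_dist x" for x
    using barycenter_close[of x] sec_dist_nonneg[of x] by (cases "x \<in> {a\<^sub>0..b\<^sub>0}") (auto simp: e_def)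
  have e_meas [measurable]: "e \<in> borel_measurable borel"
    unfolding e_def
    by (intro borel_measurable_continuous_on_indicator continuous_intros
        H.barycenter_continuous V.f_convex continuous_on_subset[OF T_continuous]) auto
  have eB: "\<bar>e x\<bar> \<le> b\<^sub>1 - a\<^sub>1" for x using e_sec_dist[of x] sec_dist_bounded[of x] by simp
  have e2: "(e x)\<^sup>2 \<le> (sec_dist x)\<^sup>2" for x using power_mono[OF e_sec_dist[of x], of 2] by simp
  have eB2: "(e x)\<^sup>2 \<le> (b\<^sub>1 - a\<^sub>1)\<^sup>2" for x using power_mono[OF eB[of x], of 2] by simp
  have "(\<integral>x. (e x)\<^sup>2 \<partial>M\<^sub>0) \<le> mean_sq_dist"
    unfolding mean_sq_dist_def using eB2
    by (intro integral_mono integrable_sec_dist e2 X.integrable_bounded[where B="(b\<^sub>1 - a\<^sub>1)\<^sup>2"]) auto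
  then have sqrt_le: "sqrt (\<integral>x. (e x)\<^sup>2 \<partial>M\<^sub>0) \<le> sqrt mean_sq_dist" by simp
  note cmpe = X.L2_norm_comparison[OF e_meas eB]
  have "sqrt l * L2_norm_on {a\<^sub>0..b\<^sub>0} e \<le> sqrt (upper_const l L) * \<epsilon> powr (1/3)"
    using order_trans[OF order_trans[OF cmpe(2) sqrt_le] sqrt_mean_sq_dist_upper[OF assms]] .
  then have "L2_norm_on {a\<^sub>0..b\<^sub>0} e \<le> sqrt (upper_const l L) / sqrt l * \<epsilon> powr (1/3)"
    using X.l_pos by (simp add: field_simps)
  moreover have "e x = H.barycenter x - T x" if "x \<in> {a\<^sub>0..b\<^sub>0}" for x using that by (simp add: e_def)
  note cong = square_integrable_on_cong[of "{a\<^sub>0..b\<^sub>0}", OF this]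
  ultimately show "L2_norm_on {a\<^sub>0..b\<^sub>0} (\<lambda>x. H.barycenter x - T x) \<le> sqrt (upper_const l L) / sqrt l * \<epsilon> powr (1/3)"
    using cong(2) by simp
  show "square_integrable_on {a\<^sub>0..b\<^sub>0} (\<lambda>x. H.barycenter x - T x)"
    using cmpe(1) cong(1) by simp
qed

end

section \<open>The marginal equations of the potentials\<close>

context two_densities
begin

text \<open>The integral depends continuously on \<open>x\<close>, by dominated convergence, and the measure charges every
subinterval.\<close>

lemma marginal_everywhere:
  assumes f: "continuous_on UNIV f" and g: "continuous_on UNIV g" and \<epsilon>: "0 < \<epsilon>"
    and ae: "AE x in M\<^sub>0. (\<integral>\<^sup>+y. ennreal (max (slack f g x y) 0 / \<epsilon>) \<partial>M\<^sub>1) = 1"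
    and x: "x \<in> {a\<^sub>0..b\<^sub>0}"
  shows "(\<integral>y. max (slack f g x y) 0 \<partial>M\<^sub>1) = \<epsilon>"
proof (rule X.continuous_AE_eq_const[OF _ _ x])
  have cont: "continuous_on UNIV (\<lambda>p. max (slack f g (fst p) (snd p)) 0)"
    unfolding slack_def
    by (intro continuous_intros continuous_on_compose2[OF f] continuous_on_compose2[OF g]) auto
  have cy: "continuous_on UNIV (\<lambda>y. max (slack f g x y) 0)"
    and cx: "continuous_on UNIV (\<lambda>x. max (slack f g x y) 0)" for x y
    unfolding slack_def
    by (intro continuous_intros continuous_on_compose2[OF f] continuous_on_compose2[OF g]; auto)+
  show "AE x in M\<^sub>0. (\<integral>y. max (slack f g x y) 0 \<partial>M\<^sub>1) = \<epsilon>"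
    using ae
  proof eventually_elim
    case (elim x)
    have "(\<integral>\<^sup>+y. ennreal (max (slack f g x y) 0 / \<epsilon>) \<partial>M\<^sub>1) = ennreal (\<integral>y. max (slack f g x y) 0 / \<epsilon> \<partial>M\<^sub>1)"
      using \<epsilon> cy Y.integrable_continuous by (intro nn_integral_eq_integral) auto
    then have "(\<integral>y. max (slack f g x y) 0 / \<epsilon> \<partial>M\<^sub>1) = 1" using elim by (simp add: ennreal_eq_1)
    then show ?case using \<epsilon> by (simp add: field_simps)
  qed
  show "continuous_on {a\<^sub>0..b\<^sub>0} (\<lambda>x. \<integral>y. max (slack f g x y) 0 \<partial>M\<^sub>1)"
    unfolding continuous_on_sequentially comp_def
  proof safe
    fix X and x assume x: "x \<in> {a\<^sub>0..b\<^sub>0}" and X: "\<forall>n::nat. X n \<in> {a\<^sub>0..b\<^sub>0}" and lim: "X \<longlonglongrightarrow> x"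
    let ?h = "\<lambda>p. max (slack f g (fst p) (snd p)) 0"
    have "compact (?h ` ({a\<^sub>0..b\<^sub>0} \<times> {a\<^sub>1..b\<^sub>1}))"
      using cont by (intro compact_continuous_image compact_Times) (auto intro: continuous_on_subset)
    then have "bounded (?h ` ({a\<^sub>0..b\<^sub>0} \<times> {a\<^sub>1..b\<^sub>1}))" by (rule compact_imp_bounded)
    then obtain B where "\<forall>z \<in> ?h ` ({a\<^sub>0..b\<^sub>0} \<times> {a\<^sub>1..b\<^sub>1}). norm z \<le> B" unfolding bounded_iff by blast
    then have B: "norm (max (slack f g x y) 0) \<le> B" if "x \<in> {a\<^sub>0..b\<^sub>0}" "y \<in> {a\<^sub>1..b\<^sub>1}" for x y
      using that by (auto simp del: real_norm_def)
    show "(\<lambda>n. \<integral>y. max (slack f g (X n) y) 0 \<partial>M\<^sub>1) \<longlonglongrightarrow> (\<integral>y. max (slack f g x y) 0 \<partial>M\<^sub>1)"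
    proof (rule integral_dominated_convergence[where w="\<lambda>_. B"])
      show "AE y in M\<^sub>1. (\<lambda>n. max (slack f g (X n) y) 0) \<longlonglongrightarrow> max (slack f g x y) 0"
        by (intro AE_I2 continuous_on_tendsto_compose[OF cx lim]) auto
      show "AE y in M\<^sub>1. norm (max (slack f g (X n) y) 0) \<le> B" for n
        using Y.AE_in_interval by eventually_elim (use B X in blast)
    qed (use borel_measurable_continuous_onI[OF cy] in \<open>auto simp: measurable_def\<close>)
  qed
qed

text \<open>The potentials are extended continuously by their values at the end points.  A plan whose density
with respect to the product measure has the prescribed form is determined by it, so that its
marginals can be computed by Tonelli's theorem and compared with those of a coupling.\<close>

lemma qot_potentials_imp_system:
  assumes pot: "qot_potentials \<epsilon> {a\<^sub>0..b\<^sub>0} {a\<^sub>1..b\<^sub>1} M\<^sub>0 M\<^sub>1 f g" and \<epsilon>: "0 < \<epsilon>"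
  obtains f' g' where "qot_system M\<^sub>0 a\<^sub>0 b\<^sub>0 u\<^sub>0 M\<^sub>1 a\<^sub>1 b\<^sub>1 u\<^sub>1 l L f' g' \<epsilon>"
    "\<And>x. x \<in> {a\<^sub>0..b\<^sub>0} \<Longrightarrow> f' x = f x" "\<And>y. y \<in> {a\<^sub>1..b\<^sub>1} \<Longrightarrow> g' y = g y"
proof -
  define f' where "f' x = f (max a\<^sub>0 (min b\<^sub>0 x))" for x
  define g' where "g' y = g (max a\<^sub>1 (min b\<^sub>1 y))" for y
  have eq: "\<And>x. x \<in> {a\<^sub>0..b\<^sub>0} \<Longrightarrow> f' x = f x" "\<And>y. y \<in> {a\<^sub>1..b\<^sub>1} \<Longrightarrow> g' y = g y"
    by (auto simp: f'_def g'_def)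
  have f: "continuous_on {a\<^sub>0..b\<^sub>0} f" and g: "continuous_on {a\<^sub>1..b\<^sub>1} g"
    using pot by (auto simp: qot_potentials_def)
  have f': "continuous_on UNIV f'"
    unfolding f'_def by (rule continuous_on_compose2[OF f]) (use X.a_less_b in \<open>auto intro!: continuous_intros\<close>)
  have g': "continuous_on UNIV g'"
    unfolding g'_def by (rule continuous_on_compose2[OF g]) (use Y.a_less_b in \<open>auto intro!: continuous_intros\<close>)
  obtain \<pi> where \<pi>: "\<pi> \<in> couplings M\<^sub>0 M\<^sub>1" "absolutely_continuous (M\<^sub>0 \<Otimes>\<^sub>M M\<^sub>1) \<pi>"
    and RN: "AE (x, y) in M\<^sub>0 \<Otimes>\<^sub>M M\<^sub>1.
             RN_deriv (M\<^sub>0 \<Otimes>\<^sub>M M\<^sub>1) \<pi> (x, y) = ennreal (max ((x * y - f x - g y) / \<epsilon>) 0)"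
    using pot unfolding qot_potentials_def qot_plan_def is_arg_min_def by blast
  define r where "r p = ennreal (max (slack f' g' (fst p) (snd p)) 0 / \<epsilon>)" for p
  have sets_\<pi> [measurable_cong]: "sets \<pi> = sets (M\<^sub>0 \<Otimes>\<^sub>M M\<^sub>1)"
    and marg: "distr \<pi> M\<^sub>0 fst = M\<^sub>0" "distr \<pi> M\<^sub>1 snd = M\<^sub>1"
    using \<pi>(1) by (auto simp: couplings_def)
  have [measurable]: "r \<in> borel_measurable (borel \<Otimes>\<^sub>M borel)"
    unfolding r_def borel_prod slack_def
    by (intro measurable_compose[OF _ measurable_ennreal] borel_measurable_continuous_onI)
       (use \<epsilon> in \<open>auto intro!: continuous_intros continuous_on_compose2[OF f'] continuous_on_compose2[OF g']\<close>)
  have "AE p in M\<^sub>0 \<Otimes>\<^sub>M M\<^sub>1. RN_deriv (M\<^sub>0 \<Otimes>\<^sub>M M\<^sub>1) \<pi> p = r p"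
    using RN AE_in_rectangle
  proof eventually_elim
    case (elim p)
    have "max (s / \<epsilon>) 0 = max s 0 / \<epsilon>" for s using \<epsilon> by (auto simp: max_def divide_simps)
    then show ?case using elim by (cases p) (simp add: r_def slack_def eq)
  qed
  then have "density (M\<^sub>0 \<Otimes>\<^sub>M M\<^sub>1) (RN_deriv (M\<^sub>0 \<Otimes>\<^sub>M M\<^sub>1) \<pi>) = density (M\<^sub>0 \<Otimes>\<^sub>M M\<^sub>1) r"
    by (intro density_cong) auto
  then have \<pi>_eq: "\<pi> = density (M\<^sub>0 \<Otimes>\<^sub>M M\<^sub>1) r"
    using P.P.density_RN_deriv[OF \<pi>(2) sets_\<pi>] by simp
  have "density M\<^sub>0 (\<lambda>x. \<integral>\<^sup>+y. r (x, y) \<partial>M\<^sub>1) = density M\<^sub>0 (\<lambda>_. 1)"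
  proof (rule measure_eqI)
    fix A assume "A \<in> sets (density M\<^sub>0 (\<lambda>x. \<integral>\<^sup>+y. r (x, y) \<partial>M\<^sub>1))"
    then have [measurable]: "A \<in> sets borel" by simp
    have "emeasure M\<^sub>0 A = emeasure (distr \<pi> M\<^sub>0 fst) A" by (simp add: marg)
    also have "\<dots> = emeasure \<pi> (fst -` A \<inter> space \<pi>)" by (rule emeasure_distr) measurable
    also have "fst -` A \<inter> space \<pi> = A \<times> UNIV" by (auto simp: \<pi>_eq space_pair_measure)
    also have "emeasure \<pi> (A \<times> UNIV) = (\<integral>\<^sup>+p. r p * indicator (A \<times> UNIV) p \<partial>(M\<^sub>0 \<Otimes>\<^sub>M M\<^sub>1))"
      unfolding \<pi>_eq by (rule emeasure_density) measurable
    also have "\<dots> = (\<integral>\<^sup>+p. r p * indicator A (fst p) \<partial>(M\<^sub>0 \<Otimes>\<^sub>M M\<^sub>1))"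
      by (intro nn_integral_cong) (auto simp: indicator_def)
    also have "\<dots> = (\<integral>\<^sup>+x. (\<integral>\<^sup>+y. r (x, y) * indicator A x \<partial>M\<^sub>1) \<partial>M\<^sub>0)"
      by (subst Y.nn_integral_fst[symmetric]) auto
    also have "\<dots> = (\<integral>\<^sup>+x. (\<integral>\<^sup>+y. r (x, y) \<partial>M\<^sub>1) * indicator A x \<partial>M\<^sub>0)"
      by (intro nn_integral_cong nn_integral_multc) auto
    also have "\<dots> = emeasure (density M\<^sub>0 (\<lambda>x. \<integral>\<^sup>+y. r (x, y) \<partial>M\<^sub>1)) A"
      by (subst emeasure_density) auto
    finally show "emeasure (density M\<^sub>0 (\<lambda>x. \<integral>\<^sup>+y. r (x, y) \<partial>M\<^sub>1)) A = emeasure (density M\<^sub>0 (\<lambda>_. 1)) A"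
      by (simp add: density_1)
  qed simp
  then have ae\<^sub>0: "AE x in M\<^sub>0. (\<integral>\<^sup>+y. r (x, y) \<partial>M\<^sub>1) = 1"
    by (intro X.density_unique) auto
  have "density M\<^sub>1 (\<lambda>y. \<integral>\<^sup>+x. r (x, y) \<partial>M\<^sub>0) = density M\<^sub>1 (\<lambda>_. 1)"
  proof (rule measure_eqI)
    fix A assume "A \<in> sets (density M\<^sub>1 (\<lambda>y. \<integral>\<^sup>+x. r (x, y) \<partial>M\<^sub>0))"
    then have [measurable]: "A \<in> sets borel" by simp
    have "emeasure M\<^sub>1 A = emeasure (distr \<pi> M\<^sub>1 snd) A" by (simp add: marg)
    also have "\<dots> = emeasure \<pi> (snd -` A \<inter> space \<pi>)" by (rule emeasure_distr) measurable
    also have "snd -` A \<inter> space \<pi> = UNIV \<times> A" by (auto simp: \<pi>_eq space_pair_measure)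
    also have "emeasure \<pi> (UNIV \<times> A) = (\<integral>\<^sup>+p. r p * indicator (UNIV \<times> A) p \<partial>(M\<^sub>0 \<Otimes>\<^sub>M M\<^sub>1))"
      unfolding \<pi>_eq by (rule emeasure_density) measurable
    also have "\<dots> = (\<integral>\<^sup>+p. r p * indicator A (snd p) \<partial>(M\<^sub>0 \<Otimes>\<^sub>M M\<^sub>1))"
      by (intro nn_integral_cong) (auto simp: indicator_def)
    also have "\<dots> = (\<integral>\<^sup>+y. (\<integral>\<^sup>+x. r (x, y) * indicator A y \<partial>M\<^sub>0) \<partial>M\<^sub>1)"
      by (subst P.nn_integral_snd[symmetric]) (auto simp: case_prod_beta')
    also have "\<dots> = (\<integral>\<^sup>+y. (\<integral>\<^sup>+x. r (x, y) \<partial>M\<^sub>0) * indicator A y \<partial>M\<^sub>1)"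
      by (intro nn_integral_cong nn_integral_multc) auto
    also have "\<dots> = emeasure (density M\<^sub>1 (\<lambda>y. \<integral>\<^sup>+x. r (x, y) \<partial>M\<^sub>0)) A"
      by (subst emeasure_density) auto
    finally show "emeasure (density M\<^sub>1 (\<lambda>y. \<integral>\<^sup>+x. r (x, y) \<partial>M\<^sub>0)) A = emeasure (density M\<^sub>1 (\<lambda>_. 1)) A"
      by (simp add: density_1)
  qed simp
  then have ae\<^sub>1: "AE y in M\<^sub>1. (\<integral>\<^sup>+x. r (x, y) \<partial>M\<^sub>0) = 1"
    by (intro Y.density_unique) auto
  have swap: "slack g' f' y x = slack f' g' x y" for x y by (simp add: slack_def mult.commute)
  have "qot_system M\<^sub>0 a\<^sub>0 b\<^sub>0 u\<^sub>0 M\<^sub>1 a\<^sub>1 b\<^sub>1 u\<^sub>1 l L f' g' \<epsilon>"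
  proof unfold_locales
    show "(\<integral>y. max (slack f' g' x y) 0 \<partial>M\<^sub>1) = \<epsilon>" if "x \<in> {a\<^sub>0..b\<^sub>0}" for x
      using marginal_everywhere[OF f' g' \<epsilon> _ that] ae\<^sub>0 by (simp add: r_def)
    show "(\<integral>x. max (slack f' g' x y) 0 \<partial>M\<^sub>0) = \<epsilon>" if "y \<in> {a\<^sub>1..b\<^sub>1}" for y
      using two_densities.marginal_everywhere[OF swapped g' f' \<epsilon> _ that] ae\<^sub>1 by (simp add: r_def swap)
  qed (use f' g' \<epsilon> in auto)
  then show ?thesis using that eq by blast
qed

end

theorem theorem2p6:
  fixes a\<^sub>0 b\<^sub>0 a\<^sub>1 b\<^sub>1 l L :: real
    and u\<^sub>0 u\<^sub>1 :: "real \<Rightarrow> real"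
    and \<mu>\<^sub>0 \<mu>\<^sub>1 :: "real measure"
  assumes "prob_space \<mu>\<^sub>0" and "prob_space \<mu>\<^sub>1"
    and "\<mu>\<^sub>0 = density lborel (\<lambda>x. ennreal (indicator {a\<^sub>0..b\<^sub>0} x * u\<^sub>0 x))"
    and "\<mu>\<^sub>1 = density lborel (\<lambda>y. ennreal (indicator {a\<^sub>1..b\<^sub>1} y * u\<^sub>1 y))"
    and "continuous_on {a\<^sub>0..b\<^sub>0} u\<^sub>0" and "continuous_on {a\<^sub>1..b\<^sub>1} u\<^sub>1"
    and "0 < l"
    and "\<forall>x\<in>{a\<^sub>0..b\<^sub>0}. l \<le> u\<^sub>0 x \<and> u\<^sub>0 x \<le> L"
    and "\<forall>y\<in>{a\<^sub>1..b\<^sub>1}. l \<le> u\<^sub>1 y \<and> u\<^sub>1 y \<le> L"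
  shows "\<exists>C>0. \<exists>\<epsilon>\<^sub>0>0. \<forall>\<epsilon> f g. 0 < \<epsilon> \<and> \<epsilon> < \<epsilon>\<^sub>0 \<and>
           qot_potentials \<epsilon> {a\<^sub>0..b\<^sub>0} {a\<^sub>1..b\<^sub>1} \<mu>\<^sub>0 \<mu>\<^sub>1 f g \<longrightarrow>
             (let T = monge_map {a\<^sub>1..b\<^sub>1} \<mu>\<^sub>0 \<mu>\<^sub>1;
                  d = (\<lambda>x. dist_to_singleton (support_section {a\<^sub>1..b\<^sub>1} f g x) (T x));
                  e = (\<lambda>x. vector_derivative f (at x within {a\<^sub>0..b\<^sub>0}) - T x)
              in square_integrable_on {a\<^sub>0..b\<^sub>0} d \<and>
                 inverse C * \<epsilon> powr (1/3) \<le> L2_norm_on {a\<^sub>0..b\<^sub>0} d \<and>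
                 L2_norm_on {a\<^sub>0..b\<^sub>0} d \<le> C * \<epsilon> powr (1/3) \<and>
                 square_integrable_on {a\<^sub>0..b\<^sub>0} e \<and>
                 L2_norm_on {a\<^sub>0..b\<^sub>0} e \<le> C * \<epsilon> powr (1/3))"
proof -
  interpret two_densities \<mu>\<^sub>0 a\<^sub>0 b\<^sub>0 u\<^sub>0 \<mu>\<^sub>1 a\<^sub>1 b\<^sub>1 u\<^sub>1 l L
    using assms
    by (intro two_densities.intro interval_density.intro interval_density_axioms.intro) auto
  define c\<^sub>1 where "c\<^sub>1 = lower_const l L / sqrt L"
  define c\<^sub>2 where "c\<^sub>2 = sqrt (upper_const l L) / sqrt l"
  define C where "C = max (inverse c\<^sub>1) c\<^sub>2"
  have c\<^sub>1: "0 < c\<^sub>1" using X.L_pos X.l_pos by (auto simp: c\<^sub>1_def lower_const_def less_max_iff_disj)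
  have C: "0 < C" "inverse C \<le> c\<^sub>1" "c\<^sub>2 \<le> C"
    using c\<^sub>1 le_imp_inverse_le[of "inverse c\<^sub>1" C] by (auto simp: C_def less_max_iff_disj)
  show ?thesis
  proof (rule exI[of _ C], rule conjI[OF C(1)], rule exI[of _ 1], rule conjI[OF zero_less_one], intro allI impI)
    fix \<epsilon> f g
    assume *: "0 < \<epsilon> \<and> \<epsilon> < 1 \<and> qot_potentials \<epsilon> {a\<^sub>0..b\<^sub>0} {a\<^sub>1..b\<^sub>1} \<mu>\<^sub>0 \<mu>\<^sub>1 f g"
    then obtain f' g' where sys: "qot_system \<mu>\<^sub>0 a\<^sub>0 b\<^sub>0 u\<^sub>0 \<mu>\<^sub>1 a\<^sub>1 b\<^sub>1 u\<^sub>1 l L f' g' \<epsilon>"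
      and f': "\<And>x. x \<in> {a\<^sub>0..b\<^sub>0} \<Longrightarrow> f' x = f x" and g': "\<And>y. y \<in> {a\<^sub>1..b\<^sub>1} \<Longrightarrow> g' y = g y"
      using qot_potentials_imp_system by blast
    interpret Q: qot_system \<mu>\<^sub>0 a\<^sub>0 b\<^sub>0 u\<^sub>0 \<mu>\<^sub>1 a\<^sub>1 b\<^sub>1 u\<^sub>1 l L f' g' \<epsilon> by (rule sys)
    have d_eq: "dist_to_singleton (support_section {a\<^sub>1..b\<^sub>1} f g x) (T x) = Q.sec_dist x" if "x \<in> {a\<^sub>0..b\<^sub>0}" for x
    proof -
      have "support_section {a\<^sub>1..b\<^sub>1} f g x = support_section {a\<^sub>1..b\<^sub>1} f' g' x"
        using f'[OF that] g' by (auto simp: support_section_def)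
      then show ?thesis using that by (simp add: Q.sec_dist_def)
    qed
    have e_eq: "vector_derivative f (at x within {a\<^sub>0..b\<^sub>0}) - T x = Q.H.barycenter x - T x"
      if x: "x \<in> {a\<^sub>0..b\<^sub>0}" for x
    proof -
      have "(f' has_real_derivative Q.H.barycenter x) (at x within {a\<^sub>0..b\<^sub>0})"
        by (rule Q.H.f_has_derivative[OF Q.V.f_convex x])
      then have "(f has_real_derivative Q.H.barycenter x) (at x within {a\<^sub>0..b\<^sub>0})"
        by (rule has_field_derivative_transform_within[OF _ zero_less_one x]) (simp add: f')
      then have "vector_derivative f (at x within {a\<^sub>0..b\<^sub>0}) = Q.H.barycenter x"
        using x X.a_less_b
        by (intro vector_derivative_within_closed_interval)
           (auto simp: has_real_derivative_iff_has_vector_derivative)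
      then show ?thesis by simp
    qed
    have congs:
      "square_integrable_on {a\<^sub>0..b\<^sub>0} (\<lambda>x. dist_to_singleton (support_section {a\<^sub>1..b\<^sub>1} f g x) (T x))
        \<longleftrightarrow> square_integrable_on {a\<^sub>0..b\<^sub>0} Q.sec_dist"
      "L2_norm_on {a\<^sub>0..b\<^sub>0} (\<lambda>x. dist_to_singleton (support_section {a\<^sub>1..b\<^sub>1} f g x) (T x))
        = L2_norm_on {a\<^sub>0..b\<^sub>0} Q.sec_dist"
      "square_integrable_on {a\<^sub>0..b\<^sub>0} (\<lambda>x. vector_derivative f (at x within {a\<^sub>0..b\<^sub>0}) - T x)
        \<longleftrightarrow> square_integrable_on {a\<^sub>0..b\<^sub>0} (\<lambda>x. Q.H.barycenter x - T x)"
      "L2_norm_on {a\<^sub>0..b\<^sub>0} (\<lambda>x. vector_derivative f (at x within {a\<^sub>0..b\<^sub>0}) - T x)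
        = L2_norm_on {a\<^sub>0..b\<^sub>0} (\<lambda>x. Q.H.barycenter x - T x)"
      by (rule square_integrable_on_cong; use d_eq e_eq in blast)+
    have "\<epsilon> < 1" using * by simp
    note est = Q.L2_estimates[OF this, folded c\<^sub>1_def c\<^sub>2_def]
    have "inverse C * \<epsilon> powr (1/3) \<le> c\<^sub>1 * \<epsilon> powr (1/3)" "c\<^sub>2 * \<epsilon> powr (1/3) \<le> C * \<epsilon> powr (1/3)"
      using C by (auto intro!: mult_right_mono)
    then show "let T = monge_map {a\<^sub>1..b\<^sub>1} \<mu>\<^sub>0 \<mu>\<^sub>1;
                  d = (\<lambda>x. dist_to_singleton (support_section {a\<^sub>1..b\<^sub>1} f g x) (T x));
                  e = (\<lambda>x. vector_derivative f (at x within {a\<^sub>0..b\<^sub>0}) - T x)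
              in square_integrable_on {a\<^sub>0..b\<^sub>0} d \<and>
                 inverse C * \<epsilon> powr (1/3) \<le> L2_norm_on {a\<^sub>0..b\<^sub>0} d \<and>
                 L2_norm_on {a\<^sub>0..b\<^sub>0} d \<le> C * \<epsilon> powr (1/3) \<and>
                 square_integrable_on {a\<^sub>0..b\<^sub>0} e \<and>
                 L2_norm_on {a\<^sub>0..b\<^sub>0} e \<le> C * \<epsilon> powr (1/3)"
      unfolding Let_def congs using est by (auto intro: order_trans)
  qed
qed

end
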